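(* Let $W_{\psi,\varphi,\max}$ be the maximal weighted composition operator on $\mathcal F^2$ induced by entire functions $\varphi,\psi$ with $\psi\not\equiv0$. The following assertions are equivalent. (1) The operator $W_{\psi,\varphi,\max}$ is normal. (2) One of the following cases occurs, for some complex constants $A,B,C,D$: (a) $\varphi(z)=Az+B$ with $A\ne1$, and $\psi(z)=Ce^{Dz}$, where $D=\overline B(1-A)(1-\overline A)^{-1}$; (b) $\varphi(z)=z+B$, and $\psi(z)=Ce^{Dz}$, where $|B|=|D|$.
   Context: The Fock space $\mathcal F^2$ is the Hilbert space of entire functions on $\mathbb C$ that are square integrable with respect to $\frac1\pi e^{-|z|^2}\,dV(z)$ ($dV$ is Lebesgue measure on $\mathbb C$), with inner product $\langle f,g\rangle=\frac1\pi\int_{\mathbb C}f(z)\overline{g(z)}e^{-|z|^2}\,dV(z)$. For entire functions $\psi,\varphi$, put $E(\psi,\varphi)f=\psi\cdot (f\circ\varphi)$. The maximal weighted composition operator $W_{\psi,\varphi,\max}$ has domain $\{f\in\mathcal F^2: E(\psi,\varphi)f\in\mathcal F^2\}$ and acts by $W_{\psi,\varphi,\max}f=E(\psi,\varphi)f$. An operator $T$ is normal if it is closed, densely defined, $\operatorname{dom}(T)=\operatorname{dom}(T^* )$ and $\|Tx\|=\|T^*x\|$ for all $x\in\operatorname{dom}(T)$. *)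

theory Defs
  imports "HOL-Complex_Analysis.Complex_Analysis"
begin

definition fock_space :: "(complex \<Rightarrow> complex) set" where
  "fock_space = {f. f holomorphic_on UNIV \<and>
     integrable lborel (\<lambda>z. (cmod (f z))\<^sup>2 * exp (- (cmod z)\<^sup>2))}"

definition fock_inner :: "(complex \<Rightarrow> complex) \<Rightarrow> (complex \<Rightarrow> complex) \<Rightarrow> complex" where
  "fock_inner f g =
     (LINT z|lborel. f z * cnj (g z) * of_real (exp (- (cmod z)\<^sup>2))) / of_real pi"

definition fock_norm :: "(complex \<Rightarrow> complex) \<Rightarrow> real" where
  "fock_norm f = sqrt (Re (fock_inner f f))"

text \<open>
  A (possibly unbounded) operator in the Fock space is a pair of its domain and its action;
  only the values of the action on the domain are relevant.
\<close>

type_synonym fock_operator =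
  "(complex \<Rightarrow> complex) set \<times> ((complex \<Rightarrow> complex) \<Rightarrow> (complex \<Rightarrow> complex))"

definition op_dom :: "fock_operator \<Rightarrow> (complex \<Rightarrow> complex) set" where
  "op_dom T = fst T"

definition op_app :: "fock_operator \<Rightarrow> (complex \<Rightarrow> complex) \<Rightarrow> (complex \<Rightarrow> complex)" where
  "op_app T = snd T"

definition densely_defined :: "fock_operator \<Rightarrow> bool" where
  "densely_defined T \<longleftrightarrow> op_dom T \<subseteq> fock_space \<and>
     (\<forall>f\<in>fock_space. \<forall>\<epsilon>>0. \<exists>g\<in>op_dom T. fock_norm (\<lambda>z. f z - g z) < \<epsilon>)"

definition closed_operator :: "fock_operator \<Rightarrow> bool" where
  "closed_operator T \<longleftrightarrow>
     (\<forall>F f g. (\<forall>n::nat. F n \<in> op_dom T) \<and> f \<in> fock_space \<and> g \<in> fock_space \<and>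
        (\<lambda>n. fock_norm (\<lambda>z. F n z - f z)) \<longlonglongrightarrow> 0 \<and>
        (\<lambda>n. fock_norm (\<lambda>z. op_app T (F n) z - g z)) \<longlonglongrightarrow> 0
        \<longrightarrow> f \<in> op_dom T \<and> op_app T f = g)"

text \<open>
  The representing element \<open>h\<close> below is unique when \<open>T\<close> is densely defined, so the adjoint is
  meaningful exactly for densely defined operators.
\<close>

definition adjoint_op :: "fock_operator \<Rightarrow> fock_operator" where
  "adjoint_op T =
     ({g \<in> fock_space. \<exists>h\<in>fock_space. \<forall>f\<in>op_dom T. fock_inner (op_app T f) g = fock_inner f h},
      \<lambda>g. THE h. h \<in> fock_space \<and> (\<forall>f\<in>op_dom T. fock_inner (op_app T f) g = fock_inner f h))"

definition normal_operator :: "fock_operator \<Rightarrow> bool" where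
  "normal_operator T \<longleftrightarrow> closed_operator T \<and> densely_defined T \<and>
     op_dom T = op_dom (adjoint_op T) \<and>
     (\<forall>f\<in>op_dom T. fock_norm (op_app T f) = fock_norm (op_app (adjoint_op T) f))"

definition weighted_comp ::
    "(complex \<Rightarrow> complex) \<Rightarrow> (complex \<Rightarrow> complex) \<Rightarrow> (complex \<Rightarrow> complex) \<Rightarrow> (complex \<Rightarrow> complex)" where
  "weighted_comp \<psi> \<phi> f = (\<lambda>z. \<psi> z * f (\<phi> z))"

definition W_max :: "(complex \<Rightarrow> complex) \<Rightarrow> (complex \<Rightarrow> complex) \<Rightarrow> fock_operator" where
  "W_max \<psi> \<phi> = ({f \<in> fock_space. weighted_comp \<psi> \<phi> f \<in> fock_space}, weighted_comp \<psi> \<phi>)"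

end

theory Submission
  imports Defs "HOL-Probability.Distributions"
begin

text \<open>
  Write \<open>W\<close> for the operator and \<open>K w z = exp (z * cnj w)\<close> for the reproducing kernel. The adjoint satisfies
  \<open>W* (K w) = cnj (\<psi> w) K (\<phi> w)\<close>, so if \<open>W\<close> is normal then every \<open>K w\<close> lies in its domain and
  \<open>norm (W (K w)) = norm (W* (K w))\<close>. Since point evaluations are bounded, this gives an inequality between
  \<open>\<psi> z\<close>, \<open>\<phi> z\<close>, \<open>\<psi> w\<close> and \<open>\<phi> w\<close>, from which \<open>\<psi>\<close> has no zeros. If \<open>\<phi> u = \<phi> v\<close> then a combination of
  \<open>K u\<close> and \<open>K v\<close> lies in the kernel of \<open>W*\<close>, hence of \<open>W\<close>; so \<open>\<phi>\<close> is constant or injective, hence affine, and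
  Liouville's theorem applied to the inequality makes \<open>\<psi>\<close> an exponential. Comparing the norms of \<open>W (K w)\<close> and
  \<open>W* (K w)\<close> once more yields the conditions on the constants.

  Conversely, let \<open>V\<close> be the operator obtained from \<open>W\<close> by replacing \<open>(A, B, C, D)\<close> by
  \<open>(cnj A, cnj D, cnj C, cnj B)\<close>. Testing against kernels gives \<open>W* \<subseteq> V\<close>. If the inclusion were strict, von
  Neumann's orthogonal decomposition of the graph space of \<open>W\<close> would provide \<open>k \<noteq> 0\<close> with \<open>W (V k) = - k\<close>; but
  \<open>W V\<close> is composition with \<open>z \<mapsto> \<bar>A\<bar>\<^sup>2 z + m\<close> weighted by a positive multiple of \<open>K m\<close>, and its formal
  positivity rules this out. So \<open>W* = V\<close>, for all constants. Finally a rigid motion of the plane carries the integral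
  for \<open>norm (W f)\<close> to that for \<open>norm (V f)\<close> under the stated conditions.
\<close>

subsection \<open>Rigid motions and the Gaussian integral\<close>

lemma nn_integral_lborel_translate:
  fixes f :: "'a::euclidean_space \<Rightarrow> ennreal"
  assumes [measurable]: "f \<in> borel_measurable borel"
  shows "(\<integral>\<^sup>+x. f (c + x) \<partial>lborel) = (\<integral>\<^sup>+x. f x \<partial>lborel)"
  using nn_integral_distr[of "(+) c" lborel borel f] by (simp add: lborel_distr_plus)

lemma borel_measurable_orthogonal_transformation:
  fixes T :: "'a::euclidean_space \<Rightarrow> 'a"
  assumes "orthogonal_transformation T"
  shows "T \<in> borel_measurable borel"
  using assms
  by (intro borel_measurable_continuous_onI linear_continuous_on linear_conv_bounded_linear[THEN iffD1]
      orthogonal_transformation_linear)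

lemma emeasure_lborel_ball_translate:
  fixes a :: "'a::euclidean_space"
  shows "emeasure lborel (ball a r) = emeasure lborel (ball (0::'a) r)"
proof -
  have "(+) (- a) -` ball 0 r = ball a r"
    by (auto simp: dist_norm norm_minus_commute)
  then show ?thesis
    using emeasure_distr[of "(+) (- a)" lborel borel "ball 0 r"] by (simp add: lborel_distr_plus)
qed

lemma nn_integral_indicator_ball_orthogonal_transformation:
  fixes T :: "'a::euclidean_space \<Rightarrow> 'a"
  assumes T: "orthogonal_transformation T"
  shows "(\<integral>\<^sup>+x. indicator (ball (T x) r) y * c \<partial>lborel) = emeasure lborel (ball (0::'a) r) * c"
proof -
  obtain a where "y = T a"
    using orthogonal_transformation_surj[OF T] by blast
  then have "indicator (ball (T x) r) y = (indicator (ball a r) x :: ennreal)" for x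
    using T by (simp add: indicator_def orthogonal_transformation_isometry dist_commute)
  then show ?thesis
    using emeasure_lborel_ball_translate[of a r] by (simp add: mult.commute[of _ c] nn_integral_cmult_indicator)
qed

text \<open>Averaging over translations by the points \<open>y\<close> of the unit ball, and using Fubini's theorem twice,
  moves \<open>T\<close> from the integrand to the ball, where it has no effect.\<close>

lemma nn_integral_lborel_orthogonal_transformation:
  fixes T :: "'a::euclidean_space \<Rightarrow> 'a" and f :: "'a \<Rightarrow> ennreal"
  assumes T: "orthogonal_transformation T" and [measurable]: "f \<in> borel_measurable borel"
  shows "(\<integral>\<^sup>+x. f (T x) \<partial>lborel) = (\<integral>\<^sup>+x. f x \<partial>lborel)"
proof -
  note [measurable] = borel_measurable_orthogonal_transformation[OF T]
  define I where "I = (\<integral>\<^sup>+x. f (T x) \<partial>lborel)"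
  define v where "v = emeasure lborel (ball (0::'a) 1)"
  have v: "v \<noteq> 0" "v < \<infinity>"
    using content_ball_pos[of 1 "0::'a"] emeasure_lborel_ball_finite[of "0::'a" 1] by (auto simp: v_def measure_def)
  have I_translate: "I = (\<integral>\<^sup>+x. f (T x + y) \<partial>lborel)" for y
  proof -
    obtain a where "y = T a"
      using orthogonal_transformation_surj[OF T] by blast
    then show ?thesis
      using nn_integral_lborel_translate[of "\<lambda>x. f (T x)" a] orthogonal_transformation_linear[OF T]
      by (simp add: I_def linear_add add.commute)
  qed
  have translate_integrand: "indicator (ball 0 1) y * I = (\<integral>\<^sup>+x. indicator (ball 0 1) y * f (T x + y) \<partial>lborel)" for y
    using I_translate[of y] by (simp add: nn_integral_cmult)
  have translate_ball: "(\<integral>\<^sup>+y. indicator (ball 0 1) y * f (T x + y) \<partial>lborel)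
      = (\<integral>\<^sup>+y. indicator (ball (T x) 1) y * f y \<partial>lborel)" for x
    using nn_integral_lborel_translate[of "\<lambda>y. indicator (ball (T x) 1) y * f y" "T x"]
    by (simp add: indicator_def dist_norm)
  have "v * I = (\<integral>\<^sup>+y. indicator (ball (0::'a) 1) y * I \<partial>lborel)"
    by (simp add: mult.commute[of _ I] nn_integral_cmult_indicator v_def)
  also have "\<dots> = (\<integral>\<^sup>+y. \<integral>\<^sup>+x. indicator (ball 0 1) y * f (T x + y) \<partial>lborel \<partial>lborel)"
    by (simp only: translate_integrand)
  also have "\<dots> = (\<integral>\<^sup>+x. \<integral>\<^sup>+y. indicator (ball 0 1) y * f (T x + y) \<partial>lborel \<partial>lborel)"
    unfolding indicator_def mem_ball by (rule lborel_pair.Fubini'[symmetric]) measurable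
  also have "\<dots> = (\<integral>\<^sup>+x. \<integral>\<^sup>+y. indicator (ball (T x) 1) y * f y \<partial>lborel \<partial>lborel)"
    by (simp only: translate_ball)
  also have "\<dots> = (\<integral>\<^sup>+y. \<integral>\<^sup>+x. indicator (ball (T x) 1) y * f y \<partial>lborel \<partial>lborel)"
    unfolding indicator_def mem_ball by (rule lborel_pair.Fubini') measurable
  also have "\<dots> = v * (\<integral>\<^sup>+x. f x \<partial>lborel)"
    by (simp add: nn_integral_indicator_ball_orthogonal_transformation[OF T] nn_integral_cmult v_def)
  finally show ?thesis
    using v by (simp add: I_def ennreal_mult_cancel_left less_top[symmetric])
qed

lemma distr_lborel_rigid_motion:
  fixes T :: "'a::euclidean_space \<Rightarrow> 'a"
  assumes T: "orthogonal_transformation T"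
  shows "distr lborel borel (\<lambda>x. T x + b) = lborel"
proof (rule measure_eqI)
  note [measurable] = borel_measurable_orthogonal_transformation[OF T]
  fix S assume "S \<in> sets (distr lborel borel (\<lambda>x. T x + b))"
  then have [measurable]: "S \<in> sets borel"
    by simp
  have "emeasure (distr lborel borel (\<lambda>x. T x + b)) S = (\<integral>\<^sup>+x. indicator S (T x + b) \<partial>lborel)"
    by (simp add: nn_integral_distr flip: nn_integral_indicator)
  also have "\<dots> = (\<integral>\<^sup>+x. indicator S (b + x) \<partial>lborel)"
    by (subst nn_integral_lborel_orthogonal_transformation[OF T]) (simp_all add: add.commute)
  also have "\<dots> = emeasure lborel S"
    by (simp add: nn_integral_lborel_translate)
  finally show "emeasure (distr lborel borel (\<lambda>x. T x + b)) S = emeasure lborel S" .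
qed simp

lemma
  fixes T :: "'a::euclidean_space \<Rightarrow> 'a" and f :: "'a \<Rightarrow> 'b::{banach, second_countable_topology}"
  assumes T: "orthogonal_transformation T" and f: "f \<in> borel_measurable borel"
  shows integrable_lborel_rigid_motion: "integrable lborel (\<lambda>x. f (T x + b)) \<longleftrightarrow> integrable lborel f"
    and integral_lborel_rigid_motion: "(LINT x|lborel. f (T x + b)) = (LINT x|lborel. f x)"
proof -
  have motion_measurable: "(\<lambda>x. T x + b) \<in> borel_measurable lborel"
    using borel_measurable_orthogonal_transformation[OF T] by simp
  show "integrable lborel (\<lambda>x. f (T x + b)) \<longleftrightarrow> integrable lborel f"
    using integrable_distr_eq[OF motion_measurable f] by (simp add: distr_lborel_rigid_motion[OF T])
  show "(LINT x|lborel. f (T x + b)) = (LINT x|lborel. f x)"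
    using integral_distr[OF motion_measurable f] by (simp add: distr_lborel_rigid_motion[OF T])
qed

lemmas integrable_lborel_translate = integrable_lborel_rigid_motion[OF orthogonal_transformation_id]
  and integral_lborel_translate = integral_lborel_rigid_motion[OF orthogonal_transformation_id]

lemma has_bochner_integral_lborel_gaussian:
  "has_bochner_integral lborel (\<lambda>x::'a::euclidean_space. exp (- (norm x)\<^sup>2)) (sqrt pi ^ DIM('a))"
proof -
  have "has_bochner_integral lborel (\<lambda>x::real. exp (- x\<^sup>2)) (sqrt pi)"
    using has_bochner_integral_even_function[OF gaussian_moment_0] by simp
  then have gaussian_real: "(\<integral>\<^sup>+x. ennreal (exp (- (x::real)\<^sup>2)) \<partial>lborel) = ennreal (sqrt pi)"
    by (subst nn_integral_eq_integral) (auto simp: has_bochner_integral_iff)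
  have "(norm x)\<^sup>2 = (\<Sum>b\<in>Basis. (x \<bullet> b)\<^sup>2)" for x :: 'a
    unfolding power2_norm_eq_inner by (subst euclidean_inner) (simp add: power2_eq_square)
  then have "exp (- (norm x)\<^sup>2) = (\<Prod>b\<in>Basis. exp (- (x \<bullet> b)\<^sup>2))" for x :: 'a
    by (simp add: exp_sum[symmetric] sum_negf)
  then have "(\<integral>\<^sup>+x. ennreal (exp (- (norm x)\<^sup>2)) \<partial>(lborel :: 'a measure))
      = (\<integral>\<^sup>+x. (\<Prod>b\<in>Basis. ennreal (exp (- (x \<bullet> b)\<^sup>2))) \<partial>(lborel :: 'a measure))"
    by (simp add: prod_ennreal)
  also have "\<dots> = (\<Prod>b\<in>(Basis :: 'a set). ennreal (sqrt pi))"
    by (subst nn_integral_lborel_prod) (simp_all add: gaussian_real)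
  also have "\<dots> = ennreal (sqrt pi ^ DIM('a))"
    by (simp add: ennreal_power)
  finally show ?thesis
    by (intro has_bochner_integral_nn_integral) auto
qed

subsection \<open>Entire functions\<close>

lemma holomorphic_on_compose_entire:
  assumes "f holomorphic_on UNIV" "g holomorphic_on S"
  shows "(\<lambda>z. f (g z)) holomorphic_on S"
  using holomorphic_on_compose_gen[OF assms(2,1)] by (simp add: comp_def)

lemma exp_mult_inject:
  fixes a b :: complex
  assumes "\<And>w. exp (a * w) = exp (b * w)"
  shows "a = b"
proof -
  have "((\<lambda>w. exp (a * w)) has_field_derivative a) (at 0)" "((\<lambda>w. exp (b * w)) has_field_derivative b) (at 0)"
    by (auto intro!: derivative_eq_intros)
  then show ?thesis
    using assms by (auto dest: DERIV_unique)
qed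

lemma entire_inj_bounded_away:
  assumes hol: "f holomorphic_on UNIV" and inj: "inj f"
  obtains d where "d > 0" "\<And>z. 1 \<le> cmod z \<Longrightarrow> d \<le> cmod (f z - f 0)"
proof -
  have "open (f ` ball 0 1)"
    by (rule open_mapping_thm3) (use hol inj in \<open>auto intro: holomorphic_on_subset inj_on_subset\<close>)
  then obtain d where d: "d > 0" "ball (f 0) d \<subseteq> f ` ball 0 1"
    unfolding open_contains_ball by (metis centre_in_ball imageI zero_less_one)
  have "d \<le> cmod (f z - f 0)" if "1 \<le> cmod z" for z
  proof (rule ccontr)
    assume "\<not> d \<le> cmod (f z - f 0)"
    then have "f z \<in> f ` ball 0 1"
      using d by (auto simp: dist_norm norm_minus_commute)
    then show False
      using that inj by (simp add: inj_image_mem_iff)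
  qed
  with d(1) show ?thesis
    using that by blast
qed

lemma entire_linear_growth_nonvanishing_imp_constant:
  assumes hol: "f holomorphic_on UNIV" and growth: "\<And>z. 1 \<le> cmod z \<Longrightarrow> cmod (f z) \<le> M * cmod z"
    and nonzero: "\<And>z. f z \<noteq> 0"
  obtains c where "c \<noteq> 0" "\<And>z. f z = c"
proof -
  have taylor: "f z = (\<Sum>i\<le>1. (deriv ^^ i) f 0 / fact i * z ^ i)" for z
    using growth by (intro Liouville_polynomial[OF hol, of 1 M]) simp
  have affine: "f z = f 0 + deriv f 0 * z" for z
    using taylor[of z] by simp
  have "deriv f 0 = 0"
  proof (rule ccontr)
    assume "deriv f 0 \<noteq> 0"
    then show False
      using affine[of "- f 0 / deriv f 0"] nonzero by simp
  qed
  then have "f z = f 0" for z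
    using affine[of z] by simp
  then show ?thesis
    using that nonzero by blast
qed

text \<open>The reciprocal of the difference quotient of \<open>f\<close> at \<open>0\<close> is a zero-free entire function of linear growth.\<close>

lemma entire_inj_imp_affine:
  assumes hol: "f holomorphic_on UNIV" and inj: "inj f"
  obtains a b where "\<And>z. f z = a * z + b"
proof -
  define q where "q z = (if z = 0 then deriv f 0 else (f z - f 0) / (z - 0))" for z
  have "q holomorphic_on UNIV"
    unfolding q_def by (rule pole_lemma[OF hol]) simp
  moreover have "deriv f 0 \<noteq> 0"
    using holomorphic_injective_imp_regular[OF hol open_UNIV inj] by simp
  then have q_nonzero: "q z \<noteq> 0" for z
    using inj by (auto simp: q_def dest: injD)
  ultimately have hol_inverse: "(\<lambda>z. 1 / q z) holomorphic_on UNIV"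
    by (intro holomorphic_intros) auto
  obtain d where d: "d > 0" "\<And>z. 1 \<le> cmod z \<Longrightarrow> d \<le> cmod (f z - f 0)"
    using entire_inj_bounded_away[OF hol inj] by blast
  have "cmod (1 / q z) \<le> 1 / d * cmod z" if "1 \<le> cmod z" for z
  proof -
    have "cmod (1 / q z) = cmod z / cmod (f z - f 0)"
      using that by (auto simp: q_def norm_divide)
    also have "\<dots> \<le> cmod z / d"
      using d that by (intro frac_le) auto
    finally show ?thesis
      by simp
  qed
  then obtain c where c: "c \<noteq> 0" "\<And>z. 1 / q z = c"
    by (rule entire_linear_growth_nonvanishing_imp_constant[OF hol_inverse]) (use q_nonzero in auto)
  have "f z = 1 / c * z + f 0" for z
  proof (cases "z = 0")
    case False
    then have "f z - f 0 = z / c"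
      using c(1) c(2)[of z] q_nonzero[of z] by (simp add: q_def field_simps)
    then show ?thesis
      by (simp add: diff_eq_eq)
  qed simp
  then show ?thesis
    using that by blast
qed

lemma multiplicative_entire_imp_exp:
  assumes hol: "f holomorphic_on UNIV" and f_0: "f 0 \<noteq> 0"
    and mult: "\<And>u h. f (u + h) * f 0 = f h * f u"
  obtains D where "\<And>z. f z = f 0 * exp (D * z)"
proof -
  define D where "D = deriv f 0 / f 0"
  have f_derivative: "(f has_field_derivative deriv f z) (at z)" for z
    using hol by (simp add: holomorphic_derivI)
  have deriv_f: "deriv f u = D * f u" for u
  proof -
    have "((\<lambda>h. f (u + h) * f 0) has_field_derivative deriv f u * f 0) (at 0)"
      using DERIV_shift[of f "deriv f u" 0 u] f_derivative[of u]
      by (auto intro!: derivative_eq_intros simp: add.commute)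
    moreover have "((\<lambda>h. f h * f u) has_field_derivative deriv f 0 * f u) (at 0)"
      by (auto intro!: derivative_eq_intros f_derivative)
    ultimately have "deriv f u * f 0 = deriv f 0 * f u"
      unfolding mult by (rule DERIV_unique)
    then show ?thesis
      using f_0 by (simp add: D_def field_simps)
  qed
  have "((\<lambda>z. f z * exp (- D * z)) has_field_derivative 0) (at z)" for z
    by (auto intro!: derivative_eq_intros f_derivative simp: deriv_f)
  then have "\<exists>c. \<forall>z\<in>UNIV. f z * exp (- D * z) = c"
    by (intro has_field_derivative_zero_constant) auto
  then obtain c where c: "\<And>z. f z * exp (- D * z) = c"
    by auto
  have "f z = f 0 * exp (D * z)" for z
    using c[of z] c[of 0] by (simp add: exp_minus field_simps)
  then show ?thesis
    using that by blast
qed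

lemma entire_antiperiodic_bounded_imp_zero:
  assumes hol: "f holomorphic_on UNIV" and antiperiodic: "\<And>z. f (z + 1) = - f z"
    and bound: "\<And>z. 0 \<le> Re z \<Longrightarrow> Re z \<le> 1 \<Longrightarrow> cmod (f z) \<le> M"
  shows "f z = 0"
proof -
  have shift: "cmod (f (z + of_int n)) = cmod (f z)" for z n
  proof (induction n rule: int_induct[where k = 0])
    case (step1 n)
    then show ?case
      using antiperiodic[of "z + of_int n"] by (simp add: add.assoc)
  next
    case (step2 n)
    then show ?case
      using antiperiodic[of "z + of_int n - 1"] by (simp add: add_diff_eq)
  qed simp
  have "cmod (f z) \<le> M" for z
  proof -
    have "cmod (f (z + of_int (- \<lfloor>Re z\<rfloor>))) \<le> M"
      by (intro bound) (simp_all, linarith)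
    then show ?thesis
      by (simp only: shift)
  qed
  then have "bounded (range f)"
    by (auto simp: bounded_iff)
  then have "f constant_on UNIV"
    by (rule Liouville_theorem[OF hol])
  then have "f (z + 1) = f z"
    by (metis UNIV_I constant_on_def)
  with antiperiodic[of z] show ?thesis
    by simp
qed

text \<open>At the fixed point of \<open>z \<mapsto> a z + m\<close> the Taylor coefficients \<open>c\<^sub>n\<close> of \<open>f\<close> satisfy \<open>\<kappa> a\<^sup>n c\<^sub>n = - c\<^sub>n\<close>.\<close>

lemma entire_affine_substitution_eq_neg_imp_zero:
  fixes a \<kappa> :: real
  assumes f: "f holomorphic_on UNIV" and \<kappa>: "\<kappa> \<ge> 0" and a: "a \<ge> 0" "a \<noteq> 1"
    and eq: "\<And>z. of_real \<kappa> * f (of_real a * z + m) = - f z"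
  shows "f z = 0"
proof -
  define p where "p = m / of_real (1 - a)"
  have p: "of_real a * p + m = p"
    using a(2) by (simp add: p_def field_simps)
  have substituted: "(\<lambda>z. f (of_real a * z + m)) holomorphic_on UNIV"
    by (intro holomorphic_on_compose_entire[OF f] holomorphic_intros)
  have "(deriv ^^ n) f p = 0" for n
  proof -
    have "of_real \<kappa> * (of_real a ^ n * (deriv ^^ n) f p) = (deriv ^^ n) (\<lambda>z. of_real \<kappa> * f (of_real a * z + m)) p"
      using higher_deriv_cmult[OF substituted, of p n "of_real \<kappa>"]
        higher_deriv_compose_linear'[OF f, of UNIV p "of_real a" m n] by (simp add: p)
    also have "\<dots> = (deriv ^^ n) (\<lambda>z. - 1 * f z) p"
      by (simp add: eq)
    also have "\<dots> = - (deriv ^^ n) f p"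
      using higher_deriv_cmult[OF f, of p n "- 1"] by simp
    finally have "of_real (\<kappa> * a ^ n + 1) * (deriv ^^ n) f p = 0"
      by (simp add: algebra_simps)
    moreover have "0 \<le> \<kappa> * a ^ n"
      using \<kappa> a by simp
    ultimately show ?thesis
      by (simp add: add_nonneg_eq_0_iff del: of_real_add of_real_mult)
  qed
  then show ?thesis
    by (intro holomorphic_fun_eq_0_on_connected[OF f, of p]) auto
qed

lemma entire_weighted_dilation_eq_neg_imp_zero:
  fixes a \<kappa> :: real
  assumes g: "g holomorphic_on UNIV" and \<kappa>: "\<kappa> \<ge> 0" and a: "a \<ge> 0" "a \<noteq> 1"
    and eq: "\<And>z. of_real \<kappa> * exp (z * cnj m) * g (of_real a * z + m) = - g z"
  shows "g z = 0"
proof -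
  define \<nu> where "\<nu> = cnj m / of_real (1 - a)"
  define f where "f z = g z * exp (- (\<nu> * z))" for z
  have f: "f holomorphic_on UNIV"
    unfolding f_def by (intro holomorphic_intros g)
  have f_eq: "of_real (\<kappa> * exp ((cmod m)\<^sup>2 / (1 - a))) * f (of_real a * z + m) = - f z" for z
  proof -
    have norm_m: "of_real ((cmod m)\<^sup>2 / (1 - a)) = \<nu> * m"
      by (simp add: \<nu>_def complex_norm_square[unfolded of_real_power] mult.commute)
    have cnj_m: "cnj m = \<nu> * of_real (1 - a)"
      using a(2) by (simp add: \<nu>_def)
    have "\<nu> * m - \<nu> * (of_real a * z + m) = z * cnj m - \<nu> * z"
      unfolding cnj_m by (simp add: algebra_simps)
    then have "of_real (exp ((cmod m)\<^sup>2 / (1 - a))) * exp (- (\<nu> * (of_real a * z + m)))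
        = exp (z * cnj m) * exp (- (\<nu> * z))"
      by (simp only: exp_of_real[symmetric] norm_m exp_add[symmetric] diff_conv_add_uminus[symmetric])
    moreover have "of_real (\<kappa> * exp ((cmod m)\<^sup>2 / (1 - a))) * f (of_real a * z + m)
        = of_real \<kappa> * g (of_real a * z + m)
          * (of_real (exp ((cmod m)\<^sup>2 / (1 - a))) * exp (- (\<nu> * (of_real a * z + m))))"
      unfolding f_def of_real_mult by (simp only: mult_ac)
    ultimately have "of_real (\<kappa> * exp ((cmod m)\<^sup>2 / (1 - a))) * f (of_real a * z + m)
        = of_real \<kappa> * exp (z * cnj m) * g (of_real a * z + m) * exp (- (\<nu> * z))"
      by (simp only: mult_ac)
    then show ?thesis
      by (simp add: eq f_def)
  qed
  have "f z = 0"
    using \<kappa> by (intro entire_affine_substitution_eq_neg_imp_zero[OF f _ a f_eq]) simp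
  then show ?thesis
    by (simp add: f_def)
qed

subsection \<open>Averages over circles\<close>

lemma measurable_cis [measurable]: "cis \<in> borel_measurable borel"
  by (intro borel_measurable_continuous_onI continuous_intros)

lemma orthogonal_transformation_mult_left:
  fixes c :: complex
  assumes "cmod c = 1"
  shows "orthogonal_transformation ((*) c)"
  using assms by (auto simp: orthogonal_transformation norm_mult bounded_linear_mult_right bounded_linear.linear)

lemma integral_circle_average:
  fixes F :: "complex \<Rightarrow> 'b::{banach, second_countable_topology}"
  assumes F: "integrable lborel F"
  shows "(LINT z|lborel. (LINT t:{0..2 * pi}|lborel. F (cis t * z))) = (2 * pi) *\<^sub>R (LINT z|lborel. F z)"
proof -
  have meas [measurable]: "F \<in> borel_measurable borel"
    using F by simp
  have rotate: "integrable lborel (\<lambda>z. F (cis t * z))" "(LINT z|lborel. F (cis t * z)) = (LINT z|lborel. F z)"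
    "(LINT z|lborel. norm (F (cis t * z))) = (LINT z|lborel. norm (F z))" for t
    using F integrable_lborel_rigid_motion[OF orthogonal_transformation_mult_left meas, of "cis t" 0]
      integral_lborel_rigid_motion[OF orthogonal_transformation_mult_left meas, of "cis t" 0]
      integral_lborel_rigid_motion[OF orthogonal_transformation_mult_left, of "cis t" "\<lambda>z. norm (F z)" 0]
    by simp_all
  define G where "G t z = indicator {0..2 * pi} t *\<^sub>R F (cis t * z)" for t z
  have "integrable (lborel \<Otimes>\<^sub>M lborel) (\<lambda>(t, z). G t z)"
    by (rule lborel_pair.Fubini_integrable) (auto simp: G_def rotate)
  then have "(LINT z|lborel. LINT t|lborel. G t z) = (LINT t|lborel. LINT z|lborel. G t z)"
    by (rule lborel_pair.Fubini_integral)
  also have "\<dots> = (LINT t|lborel. indicator {0..2 * pi} t *\<^sub>R (LINT z|lborel. F z))"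
    by (simp add: G_def rotate)
  also have "\<dots> = (2 * pi) *\<^sub>R (LINT z|lborel. F z)"
    by simp
  finally show ?thesis
    by (simp add: G_def set_lebesgue_integral_def)
qed

lemma circle_mean_value:
  assumes f: "f holomorphic_on UNIV"
  shows "(LINT t:{0..2 * pi}|lborel. f (cis t * z)) = of_real (2 * pi) * f 0"
proof -
  have hol: "(\<lambda>w. f (w * z)) holomorphic_on UNIV"
    by (intro holomorphic_on_compose_entire[OF f] holomorphic_intros)
  then have "((\<lambda>u. f (u * z) / (u - 0)) has_contour_integral 2 * of_real pi * \<i> * f (0 * z)) (circlepath 0 1)"
    by (intro Cauchy_integral_circlepath_simple) (auto intro: holomorphic_on_subset)
  then have "((\<lambda>t. \<i> * f (cis t * z)) has_integral \<i> * (of_real (2 * pi) * f 0)) {0..2 * pi}"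
    by (simp add: circlepath_def has_contour_integral_part_circlepath_iff mult_ac)
  then have "((\<lambda>t. f (cis t * z)) has_integral of_real (2 * pi) * f 0) {0..2 * pi}"
    by (subst (asm) has_integral_mult_right_iff) auto
  moreover have "set_integrable lborel {0..2 * pi} (\<lambda>t. f (cis t * z))"
    by (intro borel_integrable_atLeastAtMost' continuous_on_compose2[OF holomorphic_on_imp_continuous_on[OF hol]]
        continuous_intros) auto
  ultimately show ?thesis
    by (simp add: set_borel_integral_eq_integral integral_unique)
qed

abbreviation gaussian :: "complex \<Rightarrow> real" where
  "gaussian z \<equiv> exp (- (cmod z)\<^sup>2)"

lemma gaussian_mean_value:
  fixes f :: "complex \<Rightarrow> complex"
  assumes f: "f holomorphic_on UNIV" and int: "integrable lborel (\<lambda>z. f z * of_real (gaussian z))"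
  shows "(LINT z|lborel. f z * of_real (gaussian z)) = pi * f 0"
proof -
  have "(2 * pi) *\<^sub>R (LINT z|lborel. f z * of_real (gaussian z))
      = (LINT z|lborel. (LINT t:{0..2 * pi}|lborel. f (cis t * z) * of_real (gaussian z)))"
    using integral_circle_average[OF int] by (simp add: norm_mult)
  also have "\<dots> = (LINT z|lborel. of_real (2 * pi) * f 0 * of_real (gaussian z))"
    by (simp add: circle_mean_value[OF f])
  also have "\<dots> = of_real (2 * pi) * f 0 * of_real (LINT z|lborel. gaussian z)"
    by (simp only: integral_mult_right_zero integral_complex_of_real)
  also have "\<dots> = (2 * pi) *\<^sub>R (pi * f 0)"
    using has_bochner_integral_lborel_gaussian[where 'a = complex]
    by (simp add: has_bochner_integral_iff scaleR_conv_of_real)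
  finally show ?thesis
    by simp
qed

subsection \<open>The Fock space and its reproducing kernel\<close>

lemma holomorphic_borel_measurable: "f holomorphic_on UNIV \<Longrightarrow> f \<in> borel_measurable borel"
  by (simp add: borel_measurable_continuous_onI holomorphic_on_imp_continuous_on)

lemma fock_spaceI:
  "f holomorphic_on UNIV \<Longrightarrow> integrable lborel (\<lambda>z. (cmod (f z))\<^sup>2 * gaussian z) \<Longrightarrow> f \<in> fock_space"
  by (simp add: fock_space_def)

lemma fock_space_holomorphic: "f \<in> fock_space \<Longrightarrow> f holomorphic_on UNIV"
  by (simp add: fock_space_def)

lemma fock_space_measurable: "f \<in> fock_space \<Longrightarrow> f \<in> borel_measurable borel"
  by (simp add: holomorphic_borel_measurable fock_space_holomorphic)

lemma fock_space_integrable: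
  "f \<in> fock_space \<Longrightarrow> integrable lborel (\<lambda>z. (cmod (f z))\<^sup>2 * gaussian z)"
  by (simp add: fock_space_def)

lemma measurable_cnj [measurable]: "cnj \<in> borel_measurable borel"
  by (intro borel_measurable_continuous_onI continuous_intros)

lemma fock_inner_integrable:
  assumes "f \<in> fock_space" "g \<in> fock_space"
  shows "integrable lborel (\<lambda>z. f z * cnj (g z) * of_real (gaussian z))"
proof (rule Bochner_Integration.integrable_bound)
  note [measurable] = assms[THEN fock_space_measurable]
  show "integrable lborel (\<lambda>z. (cmod (f z))\<^sup>2 * gaussian z + (cmod (g z))\<^sup>2 * gaussian z)"
    using assms by (intro Bochner_Integration.integrable_add fock_space_integrable)
  show "(\<lambda>z. f z * cnj (g z) * of_real (gaussian z)) \<in> borel_measurable lborel"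
    by measurable
  have "cmod (f z) * cmod (g z) \<le> (cmod (f z))\<^sup>2 + (cmod (g z))\<^sup>2" for z
    using sum_squares_bound[of "cmod (f z)" "cmod (g z)"]
      mult_nonneg_nonneg[OF norm_ge_zero[of "f z"] norm_ge_zero[of "g z"]] by linarith
  then show "AE z in lborel. norm (f z * cnj (g z) * of_real (gaussian z))
      \<le> norm ((cmod (f z))\<^sup>2 * gaussian z + (cmod (g z))\<^sup>2 * gaussian z)"
    by (simp add: norm_mult flip: distrib_right)
qed

lemma fock_space_zero: "(\<lambda>z. 0) \<in> fock_space"
  by (simp add: fock_space_def)

lemma fock_space_add:
  assumes "f \<in> fock_space" "g \<in> fock_space"
  shows "(\<lambda>z. f z + g z) \<in> fock_space"
proof (rule fock_spaceI)
  show "(\<lambda>z. f z + g z) holomorphic_on UNIV"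
    using assms by (intro holomorphic_intros fock_space_holomorphic)
  note [measurable] = assms[THEN fock_space_measurable]
  show "integrable lborel (\<lambda>z. (cmod (f z + g z))\<^sup>2 * gaussian z)"
  proof (rule Bochner_Integration.integrable_bound)
    show "integrable lborel (\<lambda>z. 2 * ((cmod (f z))\<^sup>2 * gaussian z) + 2 * ((cmod (g z))\<^sup>2 * gaussian z))"
      using assms by (intro Bochner_Integration.integrable_add integrable_mult_right fock_space_integrable)
    have "(cmod (f z + g z))\<^sup>2 \<le> 2 * (cmod (f z))\<^sup>2 + 2 * (cmod (g z))\<^sup>2" for z
      using power_mono[OF norm_triangle_ineq[of "f z" "g z"], of 2] sum_squares_bound[of "cmod (f z)" "cmod (g z)"]
      by (simp add: power2_sum)
    then have "(cmod (f z + g z))\<^sup>2 * gaussian z \<le> (2 * (cmod (f z))\<^sup>2 + 2 * (cmod (g z))\<^sup>2) * gaussian z" for z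
      by (intro mult_right_mono) auto
    then show "AE z in lborel. norm ((cmod (f z + g z))\<^sup>2 * gaussian z)
       \<le> norm (2 * ((cmod (f z))\<^sup>2 * gaussian z) + 2 * ((cmod (g z))\<^sup>2 * gaussian z))"
      by (auto simp: distrib_right mult.assoc)
  qed measurable
qed

lemma fock_space_cmult:
  assumes "f \<in> fock_space"
  shows "(\<lambda>z. c * f z) \<in> fock_space"
proof (rule fock_spaceI)
  show "(\<lambda>z. c * f z) holomorphic_on UNIV"
    using assms by (intro holomorphic_intros fock_space_holomorphic)
  show "integrable lborel (\<lambda>z. (cmod (c * f z))\<^sup>2 * gaussian z)"
    using integrable_mult_right[OF fock_space_integrable[OF assms], of "(cmod c)\<^sup>2"]
    by (simp only: norm_mult power_mult_distrib mult.assoc)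
qed

lemma fock_space_uminus: "f \<in> fock_space \<Longrightarrow> (\<lambda>z. - f z) \<in> fock_space"
  using fock_space_cmult[of f "-1"] by simp

lemma fock_space_diff:
  "f \<in> fock_space \<Longrightarrow> g \<in> fock_space \<Longrightarrow> (\<lambda>z. f z - g z) \<in> fock_space"
  using fock_space_add[of f "\<lambda>z. - g z"] fock_space_uminus[of g] by simp

lemma fock_inner_add_left:
  assumes "f \<in> fock_space" "g \<in> fock_space" "h \<in> fock_space"
  shows "fock_inner (\<lambda>z. f z + g z) h = fock_inner f h + fock_inner g h"
  unfolding fock_inner_def
  by (simp add: distrib_right add_divide_distrib fock_inner_integrable assms)

lemma fock_inner_cmult_left: "fock_inner (\<lambda>z. c * f z) h = c * fock_inner f h"
  unfolding fock_inner_def by (simp add: mult.assoc)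

lemma fock_inner_diff_left:
  assumes "f \<in> fock_space" "g \<in> fock_space" "h \<in> fock_space"
  shows "fock_inner (\<lambda>z. f z - g z) h = fock_inner f h - fock_inner g h"
  using fock_inner_add_left[of f "\<lambda>z. (- 1) * g z" h] fock_inner_cmult_left[of "- 1" g h]
    fock_space_cmult[of g "- 1"] assms by simp

lemma fock_inner_commute: "fock_inner g f = cnj (fock_inner f g)"
proof -
  have "g z * cnj (f z) * of_real (gaussian z) = cnj (f z * cnj (g z) * of_real (gaussian z))" for z
    by simp
  then show ?thesis
    unfolding fock_inner_def complex_cnj_divide
    by (simp only: Bochner_Integration.integral_cnj complex_cnj_complex_of_real)
qed

lemma fock_inner_diff_right:
  assumes "f \<in> fock_space" "g \<in> fock_space" "h \<in> fock_space"
  shows "fock_inner h (\<lambda>z. f z - g z) = fock_inner h f - fock_inner h g"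
  unfolding fock_inner_commute[of h "\<lambda>z. f z - g z"] fock_inner_commute[of h f] fock_inner_commute[of h g]
  by (simp add: fock_inner_diff_left assms)

lemma fock_inner_cmult_right: "fock_inner f (\<lambda>z. c * h z) = cnj c * fock_inner f h"
  unfolding fock_inner_commute[of f "\<lambda>z. c * h z"] fock_inner_commute[of f h]
  by (simp add: fock_inner_cmult_left)

lemma fock_inner_self:
  "fock_inner f f = of_real ((LINT z|lborel. (cmod (f z))\<^sup>2 * gaussian z) / pi)"
proof -
  have "f z * cnj (f z) * of_real (gaussian z) = of_real ((cmod (f z))\<^sup>2 * gaussian z)" for z
    by (simp add: complex_norm_square[unfolded of_real_power])
  then show ?thesis
    unfolding fock_inner_def by (simp only: integral_complex_of_real of_real_divide)
qed

lemma fock_norm_power2: "(fock_norm f)\<^sup>2 = (LINT z|lborel. (cmod (f z))\<^sup>2 * gaussian z) / pi"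
  by (simp add: fock_norm_def fock_inner_self del: of_real_divide)

lemma fock_norm_nonneg [simp]: "0 \<le> fock_norm f"
  by (simp add: fock_norm_def fock_inner_self del: of_real_divide)

lemma fock_norm_cmult: "fock_norm (\<lambda>z. c * f z) = cmod c * fock_norm f"
proof -
  have "(fock_norm (\<lambda>z. c * f z))\<^sup>2 = (cmod c * fock_norm f)\<^sup>2"
    by (simp add: fock_norm_power2 norm_mult power_mult_distrib mult.assoc)
  then show ?thesis
    by (simp add: power2_eq_iff_nonneg)
qed

lemma cmod_diff_power2: "(cmod (z - w))\<^sup>2 = (cmod z)\<^sup>2 - 2 * Re (z * cnj w) + (cmod w)\<^sup>2"
  unfolding cmod_power2 by (simp add: algebra_simps power2_eq_square)

lemma norm_exp_mult_gaussian:
  "(cmod (exp (D * z)))\<^sup>2 * gaussian z = exp ((cmod D)\<^sup>2) * gaussian (z - cnj D)"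
  unfolding cmod_diff_power2
  by (simp add: norm_exp_eq_Re exp_double[symmetric] exp_add[symmetric] mult.commute)

definition fock_kernel :: "complex \<Rightarrow> complex \<Rightarrow> complex" where
  "fock_kernel w z = exp (z * cnj w)"

lemma norm_fock_kernel: "cmod (fock_kernel w z) = exp (Re (z * cnj w))"
  by (simp add: fock_kernel_def)

lemma fock_kernel_in_fock_space [simp]: "fock_kernel w \<in> fock_space"
proof (rule fock_spaceI)
  show "fock_kernel w holomorphic_on UNIV"
    unfolding fock_kernel_def by (intro holomorphic_intros)
  have "integrable lborel (\<lambda>z. gaussian (z - w))"
    using integrable_lborel_translate[of gaussian "- w"] has_bochner_integral_lborel_gaussian[where 'a = complex]
    by (simp add: has_bochner_integral_iff)
  then show "integrable lborel (\<lambda>z. (cmod (fock_kernel w z))\<^sup>2 * gaussian z)"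
    using norm_exp_mult_gaussian[of "cnj w"] by (simp add: fock_kernel_def mult.commute[of _ "cnj w"])
qed

lemma fock_reproducing:
  assumes f: "f \<in> fock_space"
  shows "fock_inner f (fock_kernel w) = f w"
proof -
  define F where "F z = f z * cnj (fock_kernel w z) * of_real (gaussian z)" for z
  define g where "g z = f (z + w) * exp (- z * cnj w)" for z
  have F: "integrable lborel F"
    unfolding F_def using f by (intro fock_inner_integrable) auto
  then have meas: "F \<in> borel_measurable borel"
    by simp
  have g: "g holomorphic_on UNIV"
    unfolding g_def by (intro holomorphic_intros holomorphic_on_compose_entire[OF fock_space_holomorphic[OF f]])
  have F_shift: "F (z + w) = g z * of_real (gaussian z)" for z
  proof -
    have "cnj ((z + w) * cnj w) + of_real (- (cmod (z + w))\<^sup>2) = - z * cnj w + of_real (- (cmod z)\<^sup>2)"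
      by (simp only: of_real_minus complex_norm_square) (simp add: algebra_simps)
    then show ?thesis
      unfolding F_def g_def fock_kernel_def
      by (simp only: exp_cnj mult.assoc exp_of_real[symmetric] exp_add[symmetric])
  qed
  have "(LINT z|lborel. F z) = (LINT z|lborel. g z * of_real (gaussian z))"
    using integral_lborel_translate[OF meas, of w] by (simp add: F_shift)
  also have "\<dots> = pi * g 0"
    using F integrable_lborel_translate[OF meas, of w] by (intro gaussian_mean_value[OF g]) (simp add: F_shift)
  finally show ?thesis
    by (simp add: fock_inner_def F_def g_def)
qed

lemma fock_norm_kernel: "fock_norm (fock_kernel w) = exp ((cmod w)\<^sup>2 / 2)"
proof -
  have "(fock_norm (fock_kernel w))\<^sup>2 = (exp ((cmod w)\<^sup>2 / 2))\<^sup>2"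
    by (simp add: fock_norm_def fock_reproducing)
       (simp add: fock_kernel_def Re_exp cmod_power2 exp_double[symmetric] flip: power2_eq_square)
  then show ?thesis
    by (simp add: power2_eq_iff_nonneg)
qed

lemma fock_norm_eq_0_iff:
  assumes f: "f \<in> fock_space"
  shows "fock_norm f = 0 \<longleftrightarrow> f = (\<lambda>z. 0)"
proof
  assume "fock_norm f = 0"
  then have "(LINT z|lborel. (cmod (f z))\<^sup>2 * gaussian z) = 0"
    using fock_norm_power2[of f] by simp
  then have "AE z in lborel. f z = 0"
    by (subst (asm) integral_nonneg_eq_0_iff_AE) (simp_all add: fock_space_integrable f)
  then have "fock_inner f h = 0" for h
    unfolding fock_inner_def by (subst integral_eq_zero_AE) auto
  then show "f = (\<lambda>z. 0)"
    using fock_reproducing[OF f] by auto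
qed (simp add: fock_norm_def fock_inner_def)

subsection \<open>The Fock space as a Hilbert space\<close>

typedef fock = fock_space
  morphisms apply_fock Fock
  using fock_space_zero by blast

setup_lifting type_definition_fock

instantiation fock :: real_inner
begin

lift_definition zero_fock :: fock is "\<lambda>z. 0"
  by (rule fock_space_zero)

lift_definition plus_fock :: "fock \<Rightarrow> fock \<Rightarrow> fock" is "\<lambda>f g z. f z + g z"
  by (rule fock_space_add)

lift_definition minus_fock :: "fock \<Rightarrow> fock \<Rightarrow> fock" is "\<lambda>f g z. f z - g z"
  by (rule fock_space_diff)

lift_definition uminus_fock :: "fock \<Rightarrow> fock" is "\<lambda>f z. - f z"
  by (rule fock_space_uminus)

lift_definition scaleR_fock :: "real \<Rightarrow> fock \<Rightarrow> fock" is "\<lambda>r f z. of_real r * f z"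
  by (rule fock_space_cmult)

lift_definition inner_fock :: "fock \<Rightarrow> fock \<Rightarrow> real" is "\<lambda>f g. Re (fock_inner f g)" .

lift_definition norm_fock :: "fock \<Rightarrow> real" is fock_norm .

definition dist_fock :: "fock \<Rightarrow> fock \<Rightarrow> real" where
  "dist_fock f g = norm (f - g)"

definition sgn_fock :: "fock \<Rightarrow> fock" where
  "sgn_fock f = inverse (norm f) *\<^sub>R f"

definition uniformity_fock :: "(fock \<times> fock) filter" where
  "uniformity_fock = (INF e\<in>{0<..}. principal {(f, g). dist f g < e})"

definition open_fock :: "fock set \<Rightarrow> bool" where
  "open_fock U = (\<forall>f\<in>U. \<forall>\<^sub>F (g, h) in uniformity. g = f \<longrightarrow> h \<in> U)"

instance
proof
  fix f g h :: fock and r s :: real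
  show "f + g + h = f + (g + h)" "f + g = g + f" "0 + f = f" "- f + f = 0" "f - g = f + - g"
    "r *\<^sub>R (f + g) = r *\<^sub>R f + r *\<^sub>R g" "(r + s) *\<^sub>R f = r *\<^sub>R f + s *\<^sub>R f"
    "r *\<^sub>R s *\<^sub>R f = (r * s) *\<^sub>R f" "1 *\<^sub>R f = f"
    by (transfer; simp add: algebra_simps)+
  show "dist f g = norm (f - g)" "sgn f = inverse (norm f) *\<^sub>R f"
    by (fact dist_fock_def sgn_fock_def)+
  show "uniformity = (INF e\<in>{0<..}. principal {(f, g :: fock). dist f g < e})"
    by (fact uniformity_fock_def)
  show "open U \<longleftrightarrow> (\<forall>f\<in>U. \<forall>\<^sub>F (g, h) in uniformity. g = f \<longrightarrow> h \<in> U)" for U :: "fock set"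
    by (fact open_fock_def)
  show "inner f g = inner g f"
    by transfer (subst fock_inner_commute, simp)
  show "inner (f + g) h = inner f h + inner g h"
    by transfer (simp add: fock_inner_add_left)
  show "inner (r *\<^sub>R f) g = r * inner f g"
    by transfer (simp add: fock_inner_cmult_left)
  show "0 \<le> inner f f"
    by transfer (simp add: fock_inner_self del: of_real_divide)
  show "inner f f = 0 \<longleftrightarrow> f = 0"
    by transfer (simp flip: fock_norm_eq_0_iff add: fock_norm_def)
  show "norm f = sqrt (inner f f)"
    by transfer (simp add: fock_norm_def)
qed

end

lemma fock_cauchy_schwarz:
  assumes f: "f \<in> fock_space" and g: "g \<in> fock_space"
  shows "cmod (fock_inner f g) \<le> fock_norm f * fock_norm g"
proof -
  define c where "c = cnj (sgn (fock_inner f g))"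
  have cf: "(\<lambda>z. c * f z) \<in> fock_space"
    by (rule fock_space_cmult[OF f])
  have "c * fock_inner f g = of_real (cmod (fock_inner f g))"
    by (simp add: c_def sgn_eq complex_norm_square[symmetric, unfolded mult.commute[of _ "cnj _"]] power2_eq_square)
  then have "cmod (fock_inner f g) = inner (Fock (\<lambda>z. c * f z)) (Fock g)"
    using cf g by (simp add: inner_fock.rep_eq Fock_inverse fock_inner_cmult_left)
  also have "\<dots> \<le> norm (Fock (\<lambda>z. c * f z)) * norm (Fock g)"
    by (rule norm_cauchy_schwarz)
  also have "\<dots> = cmod c * fock_norm f * fock_norm g"
    using cf g by (simp add: norm_fock.rep_eq Fock_inverse fock_norm_cmult)
  also have "\<dots> \<le> 1 * fock_norm f * fock_norm g"
    by (intro mult_right_mono) (auto simp: c_def norm_sgn)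
  finally show ?thesis
    by simp
qed

lemma fock_pointwise_bound:
  assumes "f \<in> fock_space"
  shows "cmod (f z) \<le> fock_norm f * exp ((cmod z)\<^sup>2 / 2)"
  using fock_cauchy_schwarz[OF assms fock_kernel_in_fock_space, of z]
  by (simp add: fock_reproducing assms fock_norm_kernel)

lemma norm_apply_fock_diff_le:
  "cmod (apply_fock f z - apply_fock g z) \<le> dist f g * exp ((cmod z)\<^sup>2 / 2)"
  using fock_pointwise_bound[OF apply_fock[of "f - g"], of z]
  by (simp add: dist_norm norm_fock.rep_eq minus_fock.rep_eq)

lemma fock_space_pointwise_limit:
  assumes F: "\<And>n. F n \<in> fock_space" and bound: "\<And>n. fock_norm (F n) \<le> B"
    and lim: "\<And>z. (\<lambda>n. F n z) \<longlonglongrightarrow> f z" and f: "f holomorphic_on UNIV"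
  shows "f \<in> fock_space" and "fock_norm f \<le> B"
proof -
  note [measurable] = fock_space_measurable[OF F] holomorphic_borel_measurable[OF f]
  have "(\<integral>\<^sup>+z. ennreal ((cmod (f z))\<^sup>2 * gaussian z) \<partial>lborel)
      = (\<integral>\<^sup>+z. liminf (\<lambda>n. ennreal ((cmod (F n z))\<^sup>2 * gaussian z)) \<partial>lborel)"
    using lim by (intro nn_integral_cong lim_imp_Liminf[symmetric] tendsto_intros) auto
  also have "\<dots> \<le> liminf (\<lambda>n. \<integral>\<^sup>+z. ennreal ((cmod (F n z))\<^sup>2 * gaussian z) \<partial>lborel)"
    by (rule nn_integral_liminf) measurable
  also have "\<dots> \<le> liminf (\<lambda>n. ennreal (pi * B\<^sup>2))"
  proof (intro Liminf_mono always_eventually allI)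
    fix n
    have "(\<integral>\<^sup>+z. ennreal ((cmod (F n z))\<^sup>2 * gaussian z) \<partial>lborel) = ennreal (pi * (fock_norm (F n))\<^sup>2)"
      by (subst nn_integral_eq_integral) (simp_all add: fock_norm_power2 fock_space_integrable F)
    also have "\<dots> \<le> ennreal (pi * B\<^sup>2)"
      using bound by (intro ennreal_leI mult_left_mono power_mono) auto
    finally show "(\<integral>\<^sup>+z. ennreal ((cmod (F n z))\<^sup>2 * gaussian z) \<partial>lborel) \<le> ennreal (pi * B\<^sup>2)" .
  qed
  finally have le: "(\<integral>\<^sup>+z. ennreal ((cmod (f z))\<^sup>2 * gaussian z) \<partial>lborel) \<le> ennreal (pi * B\<^sup>2)"
    by (simp add: Liminf_const)
  then have int: "integrable lborel (\<lambda>z. (cmod (f z))\<^sup>2 * gaussian z)"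
    by (intro integrableI_bounded) (auto simp: less_top[symmetric] top_unique)
  with f show "f \<in> fock_space"
    by (rule fock_spaceI)
  have "pi * (fock_norm f)\<^sup>2 \<le> pi * B\<^sup>2"
    using le int by (subst (asm) nn_integral_eq_integral) (simp_all add: fock_norm_power2)
  then show "fock_norm f \<le> B"
    using order_trans[OF fock_norm_nonneg bound] by (simp add: power2_le_iff_abs_le)
qed

lemma Cauchy_fock_imp_uniformly_Cauchy_on_cball:
  fixes X :: "nat \<Rightarrow> fock"
  assumes "Cauchy X"
  shows "uniformly_Cauchy_on (cball 0 r) (\<lambda>n. apply_fock (X n))"
proof (rule uniformly_Cauchy_onI)
  fix e :: real assume "e > 0"
  then obtain N where N: "\<And>m n. m \<ge> N \<Longrightarrow> n \<ge> N \<Longrightarrow> dist (X m) (X n) < e / exp (r\<^sup>2 / 2)"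
    using metric_CauchyD[OF assms, of "e / exp (r\<^sup>2 / 2)"] by auto
  have "dist (apply_fock (X m) z) (apply_fock (X n) z) < e"
    if z: "z \<in> cball 0 r" and mn: "m \<ge> N" "n \<ge> N" for z m n
  proof -
    have "dist (apply_fock (X m) z) (apply_fock (X n) z) \<le> dist (X m) (X n) * exp ((cmod z)\<^sup>2 / 2)"
      unfolding dist_complex_def by (rule norm_apply_fock_diff_le)
    also have "\<dots> \<le> dist (X m) (X n) * exp (r\<^sup>2 / 2)"
      using z by (intro mult_left_mono) (auto intro: power_mono)
    also have "\<dots> < e"
      using N[OF mn] by (simp add: pos_less_divide_eq)
    finally show ?thesis .
  qed
  then show "\<exists>N. \<forall>z\<in>cball 0 r. \<forall>m\<ge>N. \<forall>n\<ge>N. dist (apply_fock (X m) z) (apply_fock (X n) z) < e"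
    by blast
qed

lemma Cauchy_fock_entire_limit:
  fixes X :: "nat \<Rightarrow> fock"
  assumes "Cauchy X"
  obtains f where "f holomorphic_on UNIV" "\<And>z. (\<lambda>n. apply_fock (X n) z) \<longlonglongrightarrow> f z"
proof -
  define f where "f z = lim (\<lambda>n. apply_fock (X n) z)" for z
  have lim: "uniform_limit (cball 0 r) (\<lambda>n. apply_fock (X n)) f sequentially" for r
    using Cauchy_uniformly_convergent[OF Cauchy_fock_imp_uniformly_Cauchy_on_cball[OF assms]]
    unfolding f_def uniformly_convergent_uniform_limit_iff .
  have "f holomorphic_on UNIV"
  proof (rule holomorphic_uniform_sequence)
    show "apply_fock (X n) holomorphic_on UNIV" for n
      by (intro fock_space_holomorphic apply_fock)
    show "\<exists>d>0. cball z d \<subseteq> UNIV \<and> uniform_limit (cball z d) (\<lambda>n. apply_fock (X n)) f sequentially" for z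
      using uniform_limit_on_subset[OF lim[of "cmod z + 1"], of "cball z 1"]
      by (intro exI[of _ 1]) (auto simp: cball_subset_cball_iff)
  qed auto
  moreover have "(\<lambda>n. apply_fock (X n) z) \<longlonglongrightarrow> f z" for z
    using tendsto_uniform_limitI[OF lim[of "cmod z"]] by simp
  ultimately show ?thesis
    using that by blast
qed

lemma dist_fock_pointwise_limit_le:
  fixes X :: "nat \<Rightarrow> fock"
  assumes f: "f holomorphic_on UNIV" and lim: "\<And>z. (\<lambda>n. apply_fock (X n) z) \<longlonglongrightarrow> f z"
    and tail: "\<And>n. n \<ge> N \<Longrightarrow> dist (X n) g \<le> e"
  shows "dist (Fock f) g \<le> e"
proof -
  have "fock_norm (apply_fock (X (n + N) - g)) \<le> e" for n
    using tail[of "n + N"] by (simp add: dist_norm norm_fock.rep_eq)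
  moreover have "(\<lambda>n. apply_fock (X (n + N) - g) z) \<longlonglongrightarrow> f z - apply_fock g z" for z
    unfolding minus_fock.rep_eq by (intro tendsto_intros LIMSEQ_ignore_initial_segment lim)
  moreover have "(\<lambda>z. f z - apply_fock g z) holomorphic_on UNIV"
    by (intro holomorphic_intros f fock_space_holomorphic apply_fock)
  ultimately have diff: "(\<lambda>z. f z - apply_fock g z) \<in> fock_space" "fock_norm (\<lambda>z. f z - apply_fock g z) \<le> e"
    using fock_space_pointwise_limit[where F = "\<lambda>n. apply_fock (X (n + N) - g)" and B = e
        and f = "\<lambda>z. f z - apply_fock g z", OF apply_fock] by blast+
  have "f \<in> fock_space"
    using fock_space_add[OF diff(1) apply_fock[of g]] by simp
  then show ?thesis
    using diff(2) by (simp add: dist_norm norm_fock.rep_eq minus_fock.rep_eq Fock_inverse)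
qed

instance fock :: complete_space
proof
  fix X :: "nat \<Rightarrow> fock"
  assume X: "Cauchy X"
  then obtain f where f: "f holomorphic_on UNIV" and lim: "\<And>z. (\<lambda>n. apply_fock (X n) z) \<longlonglongrightarrow> f z"
    by (rule Cauchy_fock_entire_limit) blast
  have "X \<longlonglongrightarrow> Fock f"
  proof (rule metric_LIMSEQ_I)
    fix e :: real assume "e > 0"
    then obtain N where N: "\<And>m n. m \<ge> N \<Longrightarrow> n \<ge> N \<Longrightarrow> dist (X m) (X n) < e / 2"
      using metric_CauchyD[OF X, of "e / 2"] by auto
    have "dist (X n) (Fock f) < e" if "n \<ge> N" for n
    proof -
      have "dist (Fock f) (X n) \<le> e / 2"
        by (rule dist_fock_pointwise_limit_le[OF f lim, of N]) (use N that in \<open>auto intro: less_imp_le\<close>)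
      then show ?thesis
        using \<open>e > 0\<close> by (simp add: dist_commute)
    qed
    then show "\<exists>N. \<forall>n\<ge>N. dist (X n) (Fock f) < e"
      by blast
  qed
  then show "convergent X"
    by (rule convergentI)
qed

subsection \<open>Orthogonal projection and unbounded operators\<close>

lemma parallelogram_midpoint:
  fixes x y z :: "'a::real_inner"
  shows "(dist y z)\<^sup>2 = 2 * (dist x y)\<^sup>2 + 2 * (dist x z)\<^sup>2 - 4 * (dist x (midpoint y z))\<^sup>2"
  unfolding midpoint_def dist_norm power2_norm_eq_inner
  by (simp add: inner_simps inner_commute field_simps)

lemma Cauchy_minimizing_sequence:
  fixes y :: "nat \<Rightarrow> 'a::real_inner"
  assumes S: "convex S" "\<And>n. y n \<in> S" and d: "0 \<le> d" "\<And>z. z \<in> S \<Longrightarrow> d \<le> dist x z"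
    and y: "\<And>n. (dist x (y n))\<^sup>2 < d\<^sup>2 + inverse (real (Suc n))"
  shows "Cauchy y"
proof (rule metric_CauchyI)
  fix e :: real assume "e > 0"
  then obtain N where N: "inverse (real (Suc N)) < e\<^sup>2 / 4"
    using reals_Archimedean[of "e\<^sup>2 / 4"] by auto
  have y_le: "(dist x (y n))\<^sup>2 < d\<^sup>2 + e\<^sup>2 / 4" if "n \<ge> N" for n
  proof -
    have "inverse (real (Suc n)) \<le> inverse (real (Suc N))"
      using that by (intro le_imp_inverse_le) auto
    with N y[of n] show ?thesis
      by linarith
  qed
  have "dist (y m) (y n) < e" if "m \<ge> N" "n \<ge> N" for m n
  proof -
    have "midpoint (y m) (y n) \<in> S"
      using convexD[OF S(1) S(2) S(2), of "1 / 2" "1 / 2" m n] by (simp add: midpoint_def scaleR_add_right)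
    then have "d\<^sup>2 \<le> (dist x (midpoint (y m) (y n)))\<^sup>2"
      using d by (intro power_mono)
    then have "(dist (y m) (y n))\<^sup>2 < e\<^sup>2"
      using parallelogram_midpoint[of "y m" "y n" x] y_le[OF that(1)] y_le[OF that(2)] by linarith
    then show ?thesis
      using \<open>e > 0\<close> by (simp add: power_less_imp_less_base)
  qed
  then show "\<exists>N. \<forall>m\<ge>N. \<forall>n\<ge>N. dist (y m) (y n) < e"
    by blast
qed

lemma convex_closest_point_exists:
  fixes S :: "'a::{real_inner, complete_space} set"
  assumes "convex S" "closed S" "S \<noteq> {}"
  obtains p where "p \<in> S" "\<And>y. y \<in> S \<Longrightarrow> dist x p \<le> dist x y"
proof -
  define d where "d = infdist x S"
  have d: "0 \<le> d" "\<And>y. y \<in> S \<Longrightarrow> d \<le> dist x y"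
    by (auto simp: d_def infdist_nonneg infdist_le)
  have "\<exists>y\<in>S. (dist x y)\<^sup>2 < d\<^sup>2 + inverse (real (Suc n))" for n
  proof -
    have "d < sqrt (d\<^sup>2 + inverse (real (Suc n)))"
      by (rule real_less_rsqrt) simp
    then obtain y where y: "y \<in> S" "dist x y < sqrt (d\<^sup>2 + inverse (real (Suc n)))"
      using assms(3) cInf_lessD[of "dist x ` S"] by (auto simp: d_def infdist_notempty)
    then have "(dist x y)\<^sup>2 < (sqrt (d\<^sup>2 + inverse (real (Suc n))))\<^sup>2"
      by (intro power_strict_mono) auto
    with y(1) show ?thesis
      by (intro bexI[of _ y]) (simp_all add: add_nonneg_nonneg)
  qed
  then obtain y where y: "\<And>n. y n \<in> S" "\<And>n. (dist x (y n))\<^sup>2 < d\<^sup>2 + inverse (real (Suc n))"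
    by metis
  have "Cauchy y"
    using Cauchy_minimizing_sequence[OF assms(1) y(1) d y(2)] .
  then obtain p where p: "y \<longlonglongrightarrow> p"
    using Cauchy_convergent_iff convergent_def by blast
  have "(dist x p)\<^sup>2 \<le> d\<^sup>2 + 0"
  proof (rule LIMSEQ_le)
    show "(\<lambda>n. (dist x (y n))\<^sup>2) \<longlonglongrightarrow> (dist x p)\<^sup>2"
      by (intro tendsto_intros p)
    show "(\<lambda>n. d\<^sup>2 + inverse (real (Suc n))) \<longlonglongrightarrow> d\<^sup>2 + 0"
      by (intro tendsto_intros LIMSEQ_inverse_real_of_nat)
  qed (use y(2) in \<open>auto intro: less_imp_le\<close>)
  then have "dist x p \<le> d"
    using d(1) by (simp add: power2_le_iff_abs_le)
  moreover have "p \<in> S"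
    using assms(2) y(1) p by (rule closed_sequentially)
  ultimately show ?thesis
    using that d(2) by force
qed

lemma subspace_closure:
  fixes S :: "'a::real_normed_vector set"
  assumes S: "subspace S"
  shows "subspace (closure S)"
proof (rule subspaceI)
  show "0 \<in> closure S"
    using subspace_0[OF S] closure_subset by blast
next
  fix x y assume "x \<in> closure S" "y \<in> closure S"
  then obtain X Y where "\<And>n. X n \<in> S" "X \<longlonglongrightarrow> x" "\<And>n. Y n \<in> S" "Y \<longlonglongrightarrow> y"
    by (auto simp: closure_sequential)
  then show "x + y \<in> closure S"
    unfolding closure_sequential
    by (intro exI[of _ "\<lambda>n. X n + Y n"]) (simp add: subspace_add[OF S] tendsto_add)
next
  fix c :: real and x assume "x \<in> closure S"
  then obtain X where "\<And>n. X n \<in> S" "X \<longlonglongrightarrow> x"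
    by (auto simp: closure_sequential)
  then show "c *\<^sub>R x \<in> closure S"
    unfolding closure_sequential
    by (intro exI[of _ "\<lambda>n. c *\<^sub>R X n"]) (simp add: subspace_scale[OF S] tendsto_scaleR)
qed

lemma orthogonal_projection_exists:
  fixes S :: "'a::{real_inner, complete_space} set"
  assumes "subspace S" "closed S"
  obtains p where "p \<in> S" "\<And>y. y \<in> S \<Longrightarrow> orthogonal (x - p) y"
proof -
  have "convex S" "S \<noteq> {}"
    using assms(1) by (auto simp: subspace_imp_convex dest: subspace_0)
  then obtain p where p: "p \<in> S" "\<And>y. y \<in> S \<Longrightarrow> dist x p \<le> dist x y"
    using convex_closest_point_exists assms(2) by metis
  have inner_nonpos: "inner (x - p) y \<le> 0" if "y \<in> S" for y
    using any_closest_point_dot[OF \<open>convex S\<close> assms(2) p(1), of "p + y" x] p assms(1) that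
    by (simp add: subspace_add)
  have "orthogonal (x - p) y" if "y \<in> S" for y
    using inner_nonpos[OF that] inner_nonpos[OF subspace_neg[OF assms(1) that]] by (simp add: orthogonal_def)
  with p(1) show ?thesis
    using that by blast
qed

definition linear_operator :: "fock_operator \<Rightarrow> bool" where
  "linear_operator T \<longleftrightarrow> op_dom T \<subseteq> fock_space \<and> op_app T ` op_dom T \<subseteq> fock_space \<and> (\<lambda>z. 0) \<in> op_dom T \<and>
     (\<forall>f\<in>op_dom T. \<forall>g\<in>op_dom T. \<forall>c. (\<lambda>z. f z + c * g z) \<in> op_dom T \<and>
        op_app T (\<lambda>z. f z + c * g z) = (\<lambda>z. op_app T f z + c * op_app T g z))"

lemma
  assumes "linear_operator T"
  shows linear_operator_dom: "f \<in> op_dom T \<Longrightarrow> f \<in> fock_space"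
    and linear_operator_app: "f \<in> op_dom T \<Longrightarrow> op_app T f \<in> fock_space"
    and linear_operator_zero: "(\<lambda>z. 0) \<in> op_dom T" "op_app T (\<lambda>z. 0) = (\<lambda>z. 0)"
    and linear_operator_lincomb: "f \<in> op_dom T \<Longrightarrow> g \<in> op_dom T \<Longrightarrow> (\<lambda>z. f z + c * g z) \<in> op_dom T"
      "f \<in> op_dom T \<Longrightarrow> g \<in> op_dom T \<Longrightarrow>
        op_app T (\<lambda>z. f z + c * g z) = (\<lambda>z. op_app T f z + c * op_app T g z)"
proof -
  show dom: "(\<lambda>z. 0) \<in> op_dom T"
    and "f \<in> op_dom T \<Longrightarrow> f \<in> fock_space" "f \<in> op_dom T \<Longrightarrow> op_app T f \<in> fock_space"
    "f \<in> op_dom T \<Longrightarrow> g \<in> op_dom T \<Longrightarrow> (\<lambda>z. f z + c * g z) \<in> op_dom T"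
    and lincomb: "\<And>f g c. f \<in> op_dom T \<Longrightarrow> g \<in> op_dom T \<Longrightarrow>
        op_app T (\<lambda>z. f z + c * g z) = (\<lambda>z. op_app T f z + c * op_app T g z)"
    using assms unfolding linear_operator_def by blast+
  show "op_app T (\<lambda>z. 0) = (\<lambda>z. 0)"
    using lincomb[OF dom dom, of "- 1"] by simp
qed

lemma linear_operator_cmult:
  assumes "linear_operator T" "f \<in> op_dom T"
  shows "(\<lambda>z. c * f z) \<in> op_dom T" "op_app T (\<lambda>z. c * f z) = (\<lambda>z. c * op_app T f z)"
  using linear_operator_lincomb[OF assms(1) linear_operator_zero(1)[OF assms(1)] assms(2), of c]
  by (simp_all add: linear_operator_zero[OF assms(1)])

definition fock_graph :: "fock_operator \<Rightarrow> (fock \<times> fock) set" where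
  "fock_graph T = {(f, h). apply_fock f \<in> op_dom T \<and> op_app T (apply_fock f) = apply_fock h}"

lemma linear_operator_fock_graph:
  assumes "linear_operator T" "f \<in> op_dom T"
  shows "(Fock f, Fock (op_app T f)) \<in> fock_graph T"
  using assms linear_operator_dom[OF assms] linear_operator_app[OF assms]
  by (simp add: fock_graph_def Fock_inverse)

lemma closed_fock_graph:
  assumes "closed_operator T"
  shows "closed (fock_graph T)"
  unfolding closed_sequential_limits
proof (intro allI impI, elim conjE)
  fix X and p :: "fock \<times> fock"
  assume X: "\<forall>n. X n \<in> fock_graph T" and "X \<longlonglongrightarrow> p"
  then have "(\<lambda>n. fst (X n) - fst p) \<longlonglongrightarrow> 0" "(\<lambda>n. snd (X n) - snd p) \<longlonglongrightarrow> 0"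
    by (intro LIM_zero tendsto_intros; simp)+
  then have "(\<lambda>n. norm (fst (X n) - fst p)) \<longlonglongrightarrow> 0" "(\<lambda>n. norm (snd (X n) - snd p)) \<longlonglongrightarrow> 0"
    by (simp_all only: tendsto_norm_zero_iff)
  moreover have "apply_fock (fst (X n)) \<in> op_dom T" "op_app T (apply_fock (fst (X n))) = apply_fock (snd (X n))" for n
    using X by (auto simp: fock_graph_def split_beta)
  ultimately have "apply_fock (fst p) \<in> op_dom T \<and> op_app T (apply_fock (fst p)) = apply_fock (snd p)"
    using assms[unfolded closed_operator_def, rule_format,
        of "\<lambda>n. apply_fock (fst (X n))" "apply_fock (fst p)" "apply_fock (snd p)"]
    by (simp add: norm_fock.rep_eq minus_fock.rep_eq apply_fock)
  then show "p \<in> fock_graph T"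
    by (simp add: fock_graph_def split_beta)
qed

lemma subspace_fock_graph:
  assumes T: "linear_operator T"
  shows "subspace (fock_graph T)"
proof (rule subspaceI)
  show "0 \<in> fock_graph T"
    by (simp add: fock_graph_def zero_prod_def zero_fock.rep_eq linear_operator_zero[OF T])
next
  fix p q assume "p \<in> fock_graph T" "q \<in> fock_graph T"
  then show "p + q \<in> fock_graph T"
    using linear_operator_lincomb[OF T, of "apply_fock (fst p)" "apply_fock (fst q)" 1]
    by (auto simp: fock_graph_def plus_fock.rep_eq)
next
  fix r :: real and p assume "p \<in> fock_graph T"
  then show "r *\<^sub>R p \<in> fock_graph T"
    using linear_operator_cmult[OF T, of "apply_fock (fst p)" "of_real r"]
    by (auto simp: fock_graph_def scaleR_fock.rep_eq)
qed

text \<open>The residual of the projection of \<open>(u, v)\<close> onto the graph of \<open>T\<close> lies in the orthogonal complement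
  of the graph, which is the flipped graph of the adjoint.\<close>

lemma closed_operator_graph_decomposition:
  assumes T: "linear_operator T" "closed_operator T" and u: "u \<in> fock_space" and v: "v \<in> fock_space"
  obtains f where "f \<in> op_dom T"
    "\<And>g. g \<in> op_dom T \<Longrightarrow>
      fock_inner (op_app T g) (\<lambda>z. v z - op_app T f z) = fock_inner g (\<lambda>z. f z - u z)"
proof -
  obtain p where p: "p \<in> fock_graph T" "\<And>q. q \<in> fock_graph T \<Longrightarrow> orthogonal ((Fock u, Fock v) - p) q"
    using orthogonal_projection_exists[OF subspace_fock_graph closed_fock_graph] T by blast
  define f where "f = apply_fock (fst p)"
  have f: "f \<in> op_dom T" "apply_fock (snd p) = op_app T f"
    using p(1) by (auto simp: f_def fock_graph_def)
  note fock = linear_operator_dom[OF T(1)] linear_operator_app[OF T(1)]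
  define defect where
    "defect g = fock_inner (op_app T g) (\<lambda>z. v z - op_app T f z) - fock_inner g (\<lambda>z. f z - u z)" for g
  have Re_defect: "Re (defect g) = 0" if g: "g \<in> op_dom T" for g
  proof -
    from p(2)[OF linear_operator_fock_graph[OF T(1) g]]
    have "inner (Fock g) (Fock u - fst p) + inner (Fock (op_app T g)) (Fock v - snd p) = 0"
      by (simp add: orthogonal_def inner_prod_def inner_commute)
    then show ?thesis
      using f(1) g u v
      by (simp add: defect_def inner_fock.rep_eq minus_fock.rep_eq Fock_inverse fock f(2) f_def[symmetric]
          fock_inner_diff_right)
  qed
  have "defect g = 0" if g: "g \<in> op_dom T" for g
  proof -
    have "defect (\<lambda>z. \<i> * g z) = \<i> * defect g"
      by (simp add: defect_def linear_operator_cmult[OF T(1) g] fock_inner_cmult_left right_diff_distrib)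
    then show ?thesis
      using Re_defect[OF g] Re_defect[OF linear_operator_cmult(1)[OF T(1) g, of \<i>]]
      by (simp add: complex_eq_iff)
  qed
  with f(1) show ?thesis
    using that by (simp add: defect_def)
qed

lemma densely_defined_iff_closure:
  assumes "op_dom T \<subseteq> fock_space"
  shows "densely_defined T \<longleftrightarrow> closure (Fock ` op_dom T) = UNIV"
proof -
  have "fock_norm (\<lambda>z. f z - g z) = dist (Fock g) (Fock f)" if "f \<in> fock_space" "g \<in> op_dom T" for f g
    using that subsetD[OF assms]
    by (subst dist_commute) (simp add: dist_norm norm_fock.rep_eq minus_fock.rep_eq Fock_inverse)
  then have "densely_defined T \<longleftrightarrow> (\<forall>f\<in>fock_space. Fock f \<in> closure (Fock ` op_dom T))"
    using assms by (auto simp: densely_defined_def closure_approachable)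
  also have "\<dots> \<longleftrightarrow> closure (Fock ` op_dom T) = UNIV"
    by (metis Fock_cases UNIV_I UNIV_eq_I)
  finally show ?thesis .
qed

lemma subspace_Fock_op_dom:
  assumes T: "linear_operator T"
  shows "subspace (Fock ` op_dom T)"
proof -
  have "Fock ` op_dom T = fst ` fock_graph T"
  proof (intro equalityI subsetI)
    fix x assume "x \<in> Fock ` op_dom T"
    then show "x \<in> fst ` fock_graph T"
      using linear_operator_fock_graph[OF T] by (metis (no_types) fst_conv imageE image_eqI)
  next
    fix x assume "x \<in> fst ` fock_graph T"
    then have "apply_fock x \<in> op_dom T"
      by (auto simp: fock_graph_def)
    then show "x \<in> Fock ` op_dom T"
      by (metis apply_fock_inverse image_eqI)
  qed
  then show ?thesis
    using linear_subspace_image[OF linear_fst subspace_fock_graph[OF T]] by simp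
qed

lemma densely_defined_if_kernels_in_dom:
  assumes T: "linear_operator T" and kernels: "\<And>w. fock_kernel w \<in> op_dom T"
  shows "densely_defined T"
proof -
  let ?S = "Fock ` op_dom T"
  have "x \<in> closure ?S" for x
  proof -
    obtain p where p: "p \<in> closure ?S" "\<And>y. y \<in> closure ?S \<Longrightarrow> orthogonal (x - p) y"
      using orthogonal_projection_exists[OF subspace_closure[OF subspace_Fock_op_dom[OF T]] closed_closure] by blast
    have "apply_fock (x - p) w = 0" for w
    proof -
      define a where "a = apply_fock (x - p) w"
      have "(\<lambda>z. a * fock_kernel w z) \<in> op_dom T"
        by (intro linear_operator_cmult T kernels)
      then have "Fock (\<lambda>z. a * fock_kernel w z) \<in> closure ?S"
        by (intro subsetD[OF closure_subset] imageI)
      then have "inner (x - p) (Fock (\<lambda>z. a * fock_kernel w z)) = 0"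
        using p(2) by (simp add: orthogonal_def)
      then have "Re (cnj a * a) = 0"
        by (simp add: inner_fock.rep_eq Fock_inverse fock_space_cmult fock_inner_cmult_right
            fock_reproducing apply_fock a_def)
      moreover have "Re (cnj a * a) = (cmod a)\<^sup>2"
        unfolding cmod_power2 by (simp add: power2_eq_square)
      ultimately show ?thesis
        by (simp add: a_def)
    qed
    then have "x - p = 0"
      by (simp add: apply_fock_inject[symmetric] zero_fock.rep_eq fun_eq_iff)
    with p(1) show ?thesis
      by simp
  qed
  moreover have "op_dom T \<subseteq> fock_space"
    using linear_operator_dom[OF T] by blast
  ultimately show ?thesis
    by (auto simp: densely_defined_iff_closure)
qed

lemma fock_inner_eq_on_dense:
  assumes T: "densely_defined T" and h: "h \<in> fock_space" "k \<in> fock_space"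
    and eq: "\<And>f. f \<in> op_dom T \<Longrightarrow> fock_inner f h = fock_inner f k"
  shows "h = k"
proof -
  have dom: "op_dom T \<subseteq> fock_space"
    using T by (simp add: densely_defined_def)
  have "closed {x. inner x (Fock h - Fock k) = 0}"
    by (intro closed_Collect_eq continuous_intros)
  moreover have "Fock ` op_dom T \<subseteq> {x. inner x (Fock h - Fock k) = 0}"
    using dom h eq
    by (auto simp: inner_fock.rep_eq minus_fock.rep_eq Fock_inverse fock_inner_diff_right subset_iff)
  ultimately have "Fock h - Fock k \<in> {x. inner x (Fock h - Fock k) = 0}"
    using T[unfolded densely_defined_iff_closure[OF dom]] closure_minimal by blast
  then show ?thesis
    using h by (simp add: Fock_inject)
qed

lemma
  assumes T: "densely_defined T" and fock: "g \<in> fock_space" "h \<in> fock_space"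
    and adj: "\<And>f. f \<in> op_dom T \<Longrightarrow> fock_inner (op_app T f) g = fock_inner f h"
  shows op_dom_adjointI: "g \<in> op_dom (adjoint_op T)"
    and op_app_adjoint_eq: "op_app (adjoint_op T) g = h"
proof -
  show "g \<in> op_dom (adjoint_op T)"
    using fock adj by (auto simp: adjoint_op_def op_dom_def)
  have "(THE h. h \<in> fock_space \<and> (\<forall>f\<in>op_dom T. fock_inner (op_app T f) g = fock_inner f h)) = h"
    using fock adj by (intro the_equality fock_inner_eq_on_dense[OF T]) auto
  then show "op_app (adjoint_op T) g = h"
    by (simp add: adjoint_op_def op_app_def)
qed

lemma op_dom_adjointE:
  assumes "g \<in> op_dom (adjoint_op T)"
  obtains h where "g \<in> fock_space" "h \<in> fock_space"
    "\<And>f. f \<in> op_dom T \<Longrightarrow> fock_inner (op_app T f) g = fock_inner f h"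
  using assms by (auto simp: adjoint_op_def op_dom_def)

subsection \<open>Maximal weighted composition operators\<close>

lemma op_dom_W_max: "op_dom (W_max \<psi> \<phi>) = {f \<in> fock_space. weighted_comp \<psi> \<phi> f \<in> fock_space}"
  by (simp add: W_max_def op_dom_def)

lemma op_app_W_max: "op_app (W_max \<psi> \<phi>) = weighted_comp \<psi> \<phi>"
  by (simp add: W_max_def op_app_def)

lemma linear_operator_W_max: "linear_operator (W_max \<psi> \<phi>)"
proof -
  have lincomb: "weighted_comp \<psi> \<phi> (\<lambda>z. f z + c * g z)
      = (\<lambda>z. weighted_comp \<psi> \<phi> f z + c * weighted_comp \<psi> \<phi> g z)" for f g c
    by (simp add: weighted_comp_def algebra_simps)
  have "weighted_comp \<psi> \<phi> (\<lambda>z. 0) = (\<lambda>z. 0)"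
    by (simp add: weighted_comp_def)
  then show ?thesis
    by (auto simp: linear_operator_def op_dom_W_max op_app_W_max lincomb
        fock_space_zero fock_space_add fock_space_cmult)
qed

lemma tendsto_fock_norm_imp_pointwise:
  assumes "\<And>n. F n \<in> fock_space" "f \<in> fock_space" and lim: "(\<lambda>n. fock_norm (\<lambda>z. F n z - f z)) \<longlonglongrightarrow> 0"
  shows "(\<lambda>n. F n z) \<longlonglongrightarrow> f z"
proof (rule LIM_zero_cancel, rule Lim_null_comparison)
  show "\<forall>\<^sub>F n in sequentially. norm (F n z - f z) \<le> fock_norm (\<lambda>z. F n z - f z) * exp ((cmod z)\<^sup>2 / 2)"
    using fock_pointwise_bound[OF fock_space_diff[OF assms(1,2)]] by simp
  show "(\<lambda>n. fock_norm (\<lambda>z. F n z - f z) * exp ((cmod z)\<^sup>2 / 2)) \<longlonglongrightarrow> 0"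
    using lim by (rule tendsto_mult_left_zero)
qed

lemma closed_operator_W_max: "closed_operator (W_max \<psi> \<phi>)"
  unfolding closed_operator_def
proof (intro allI impI, elim conjE)
  fix F f g
  assume F: "\<forall>n::nat. F n \<in> op_dom (W_max \<psi> \<phi>)" and f: "f \<in> fock_space" and g: "g \<in> fock_space"
    and Ff: "(\<lambda>n. fock_norm (\<lambda>z. F n z - f z)) \<longlonglongrightarrow> 0"
    and Fg: "(\<lambda>n. fock_norm (\<lambda>z. op_app (W_max \<psi> \<phi>) (F n) z - g z)) \<longlonglongrightarrow> 0"
  have "weighted_comp \<psi> \<phi> f z = g z" for z
  proof (rule LIMSEQ_unique)
    show "(\<lambda>n. weighted_comp \<psi> \<phi> (F n) z) \<longlonglongrightarrow> weighted_comp \<psi> \<phi> f z"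
      unfolding weighted_comp_def using F f Ff
      by (intro tendsto_mult tendsto_const tendsto_fock_norm_imp_pointwise) (auto simp: op_dom_W_max)
    show "(\<lambda>n. weighted_comp \<psi> \<phi> (F n) z) \<longlonglongrightarrow> g z"
      using F g Fg by (intro tendsto_fock_norm_imp_pointwise) (auto simp: op_dom_W_max op_app_W_max)
  qed
  then have "weighted_comp \<psi> \<phi> f = g"
    by auto
  then show "f \<in> op_dom (W_max \<psi> \<phi>) \<and> op_app (W_max \<psi> \<phi>) f = g"
    using f g by (simp add: op_dom_W_max op_app_W_max)
qed

lemma adjoint_W_max_kernel:
  assumes "densely_defined (W_max \<psi> \<phi>)"
  shows "fock_kernel w \<in> op_dom (adjoint_op (W_max \<psi> \<phi>))"
    and "op_app (adjoint_op (W_max \<psi> \<phi>)) (fock_kernel w) = (\<lambda>z. cnj (\<psi> w) * fock_kernel (\<phi> w) z)"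
proof -
  have adj: "fock_inner (op_app (W_max \<psi> \<phi>) f) (fock_kernel w)
      = fock_inner f (\<lambda>z. cnj (\<psi> w) * fock_kernel (\<phi> w) z)" if "f \<in> op_dom (W_max \<psi> \<phi>)" for f
    using that
    by (simp add: op_dom_W_max op_app_W_max fock_reproducing fock_inner_cmult_right)
      (simp add: weighted_comp_def)
  show "fock_kernel w \<in> op_dom (adjoint_op (W_max \<psi> \<phi>))"
    by (rule op_dom_adjointI[OF assms _ _ adj]) (auto intro: fock_space_cmult)
  show "op_app (adjoint_op (W_max \<psi> \<phi>)) (fock_kernel w) = (\<lambda>z. cnj (\<psi> w) * fock_kernel (\<phi> w) z)"
    by (rule op_app_adjoint_eq[OF assms _ _ adj]) (auto intro: fock_space_cmult)
qed

lemma
  assumes "normal_operator (W_max \<psi> \<phi>)"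
  shows normal_W_max_kernel_in_fock_space: "weighted_comp \<psi> \<phi> (fock_kernel w) \<in> fock_space"
    and normal_W_max_kernel_norm:
      "fock_norm (weighted_comp \<psi> \<phi> (fock_kernel w)) = cmod (\<psi> w) * exp ((cmod (\<phi> w))\<^sup>2 / 2)"
proof -
  have "densely_defined (W_max \<psi> \<phi>)"
    using assms by (simp add: normal_operator_def)
  note adj = adjoint_W_max_kernel[OF this, of w]
  have dom: "fock_kernel w \<in> op_dom (W_max \<psi> \<phi>)"
    using adj(1) assms by (simp add: normal_operator_def)
  then show "weighted_comp \<psi> \<phi> (fock_kernel w) \<in> fock_space"
    by (simp add: op_dom_W_max)
  have "fock_norm (weighted_comp \<psi> \<phi> (fock_kernel w)) = fock_norm (\<lambda>z. cnj (\<psi> w) * fock_kernel (\<phi> w) z)"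
    using assms dom adj(2) by (simp add: normal_operator_def op_app_W_max)
  then show "fock_norm (weighted_comp \<psi> \<phi> (fock_kernel w)) = cmod (\<psi> w) * exp ((cmod (\<phi> w))\<^sup>2 / 2)"
    by (simp add: fock_norm_cmult fock_norm_kernel)
qed

lemma normal_W_max_bound:
  assumes "normal_operator (W_max \<psi> \<phi>)"
  shows "cmod (\<psi> z) \<le> cmod (\<psi> w) * exp ((cmod (\<phi> w))\<^sup>2 / 2 + (cmod z)\<^sup>2 / 2 - Re (\<phi> z * cnj w))"
proof -
  have "cmod (\<psi> z) * exp (Re (\<phi> z * cnj w)) = cmod (weighted_comp \<psi> \<phi> (fock_kernel w) z)"
    by (simp add: weighted_comp_def norm_mult norm_fock_kernel)
  also have "\<dots> \<le> cmod (\<psi> w) * exp ((cmod (\<phi> w))\<^sup>2 / 2) * exp ((cmod z)\<^sup>2 / 2)"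
    using fock_pointwise_bound[OF normal_W_max_kernel_in_fock_space[OF assms]]
    by (simp add: normal_W_max_kernel_norm[OF assms])
  finally show ?thesis
    by (simp only: exp_add exp_diff times_divide_eq_right pos_le_divide_eq exp_gt_zero mult.assoc)
qed

lemma normal_W_max_nonvanishing:
  assumes "normal_operator (W_max \<psi> \<phi>)" "\<exists>z. \<psi> z \<noteq> 0"
  shows "\<psi> w \<noteq> 0"
  using normal_W_max_bound[OF assms(1), of _ w] assms(2) by auto

lemma normal_operator_adjoint_kernel:
  assumes T: "linear_operator T" "normal_operator T" and g: "g \<in> fock_space"
    and orth: "\<And>f. f \<in> op_dom T \<Longrightarrow> fock_inner (op_app T f) g = 0"
  shows "g \<in> op_dom T" "op_app T g = (\<lambda>z. 0)"
proof -
  have dense: "densely_defined T"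
    using T(2) by (simp add: normal_operator_def)
  have adj: "fock_inner (op_app T f) g = fock_inner f (\<lambda>z. 0)" if "f \<in> op_dom T" for f
    using orth[OF that] by (simp add: fock_inner_def)
  show dom: "g \<in> op_dom T"
    using op_dom_adjointI[OF dense g fock_space_zero adj] T(2) by (simp add: normal_operator_def)
  have "fock_norm (op_app T g) = 0"
    using op_app_adjoint_eq[OF dense g fock_space_zero adj] T(2) dom fock_norm_eq_0_iff[OF fock_space_zero]
    by (simp add: normal_operator_def)
  then show "op_app T g = (\<lambda>z. 0)"
    using fock_norm_eq_0_iff[OF linear_operator_app[OF T(1) dom]] by simp
qed

lemma fock_kernel_proportional_imp_eq:
  assumes "\<And>z. a * fock_kernel u z = b * fock_kernel v z" "b \<noteq> 0"
  shows "u = v"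
proof -
  have "a = b"
    using assms(1)[of 0] by (simp add: fock_kernel_def)
  then have "exp (cnj u * z) = exp (cnj v * z)" for z
    using assms(1)[of z] assms(2) by (simp add: fock_kernel_def mult.commute)
  then show ?thesis
    using exp_mult_inject[of "cnj u" "cnj v"] by simp
qed

lemma normal_W_max_inj:
  assumes hol: "\<phi> holomorphic_on UNIV" and normal: "normal_operator (W_max \<psi> \<phi>)"
    and nonzero: "\<exists>z. \<psi> z \<noteq> 0" and nonconstant: "\<not> \<phi> constant_on UNIV"
  shows "inj \<phi>"
proof (rule injI)
  fix u v assume same_image: "\<phi> u = \<phi> v"
  note nonvanishing = normal_W_max_nonvanishing[OF normal nonzero]
  define g where "g = (\<lambda>z. cnj (\<psi> v) * fock_kernel u z - cnj (\<psi> u) * fock_kernel v z)"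
  have g: "g \<in> fock_space"
    unfolding g_def by (intro fock_space_diff fock_space_cmult fock_kernel_in_fock_space)
  have "fock_inner (op_app (W_max \<psi> \<phi>) f) g = 0" if "f \<in> op_dom (W_max \<psi> \<phi>)" for f
  proof -
    have "fock_inner (weighted_comp \<psi> \<phi> f) g
        = \<psi> v * weighted_comp \<psi> \<phi> f u - \<psi> u * weighted_comp \<psi> \<phi> f v"
      unfolding g_def using that
      by (simp add: op_dom_W_max fock_inner_diff_right fock_space_cmult fock_inner_cmult_right fock_reproducing)
    then show ?thesis
      by (simp add: op_app_W_max weighted_comp_def same_image)
  qed
  then have "weighted_comp \<psi> \<phi> g = (\<lambda>z. 0)"
    using normal_operator_adjoint_kernel(2)[OF linear_operator_W_max normal g] by (simp add: op_app_W_max)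
  then have "\<psi> z * g (\<phi> z) = 0" for z
    by (simp add: weighted_comp_def fun_eq_iff)
  then have g_range: "g (\<phi> z) = 0" for z
    using nonvanishing by simp
  have "open (range \<phi>)"
    using hol nonconstant by (intro open_mapping_thm[of \<phi> UNIV UNIV]) auto
  then have "g z = 0" for z
    by (rule analytic_continuation_open[of "range \<phi>" UNIV g "\<lambda>_. 0"])
      (use g_range fock_space_holomorphic[OF g] in auto)
  then have "cnj (\<psi> v) * fock_kernel u z = cnj (\<psi> u) * fock_kernel v z" for z
    by (simp add: g_def)
  then show "u = v"
    by (rule fock_kernel_proportional_imp_eq) (simp add: nonvanishing)
qed

lemma normal_W_max_affine:
  assumes hol: "\<phi> holomorphic_on UNIV" and normal: "normal_operator (W_max \<psi> \<phi>)" and nonzero: "\<exists>z. \<psi> z \<noteq> 0"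
  obtains A B where "\<phi> = (\<lambda>z. A * z + B)"
proof (cases "\<phi> constant_on UNIV")
  case True
  then obtain B where "\<phi> = (\<lambda>z. 0 * z + B)"
    by (auto simp: constant_on_def)
  then show ?thesis
    by (rule that)
next
  case False
  then obtain A B where "\<And>z. \<phi> z = A * z + B"
    using entire_inj_imp_affine[OF hol normal_W_max_inj[OF hol normal nonzero]] by blast
  then show ?thesis
    using that by blast
qed

text \<open>The pointwise bound along \<open>z = cnj A * w + h\<close> has matching Gaussian factors on both sides, so
  Liouville's theorem applies to the quotient.\<close>

lemma normal_W_max_functional_equation:
  assumes hol: "\<psi> holomorphic_on UNIV" and normal: "normal_operator (W_max \<psi> (\<lambda>z. A * z + B))"
    and nonzero: "\<exists>z. \<psi> z \<noteq> 0"
  shows "\<psi> (cnj A * w + h) * \<psi> 0 = \<psi> h * \<psi> w * exp ((A - 1) * cnj B * w)"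
proof -
  note nonvanishing = normal_W_max_nonvanishing[OF normal nonzero]
  define q where "q w = \<psi> (cnj A * w + h) / (\<psi> w * exp ((A - 1) * cnj B * w))" for w
  have q: "q holomorphic_on UNIV"
    unfolding q_def using hol nonvanishing
    by (intro holomorphic_intros holomorphic_on_compose_entire[OF hol]) auto
  have "cmod (q w) \<le> exp ((cmod B)\<^sup>2 / 2 + (cmod h)\<^sup>2 / 2)" for w
  proof -
    define z where "z = cnj A * w + h"
    have "(cmod (A * w + B))\<^sup>2 / 2 + (cmod z)\<^sup>2 / 2 - Re ((A * z + B) * cnj w)
        = Re ((A - 1) * cnj B * w) + ((cmod B)\<^sup>2 / 2 + (cmod h)\<^sup>2 / 2)"
      unfolding z_def cmod_power2
      by (simp add: algebra_simps power2_eq_square add_divide_distrib diff_divide_distrib)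
    then have "cmod (\<psi> z) \<le> cmod (\<psi> w) * exp (Re ((A - 1) * cnj B * w)) * exp ((cmod B)\<^sup>2 / 2 + (cmod h)\<^sup>2 / 2)"
      using normal_W_max_bound[OF normal, of z w] by (simp only: exp_add mult.assoc)
    then have "cmod (\<psi> z) / (cmod (\<psi> w) * exp (Re ((A - 1) * cnj B * w))) \<le> exp ((cmod B)\<^sup>2 / 2 + (cmod h)\<^sup>2 / 2)"
      using nonvanishing[of w] by (subst pos_divide_le_eq) (simp_all add: mult_ac)
    then show ?thesis
      by (simp only: q_def z_def norm_divide norm_mult norm_exp_eq_Re)
  qed
  then have "bounded (range q)"
    by (auto simp: bounded_iff)
  then have "q constant_on UNIV"
    by (rule Liouville_theorem[OF q])
  then have "q w = q 0"
    by (metis UNIV_I constant_on_def)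
  then show ?thesis
    using nonvanishing[of w] nonvanishing[of 0] by (simp add: q_def field_simps)
qed

lemma normal_W_max_exp:
  assumes hol: "\<psi> holomorphic_on UNIV" and normal: "normal_operator (W_max \<psi> (\<lambda>z. A * z + B))"
    and nonzero: "\<exists>z. \<psi> z \<noteq> 0"
  obtains C D where "C \<noteq> 0" "\<psi> = (\<lambda>z. C * exp (D * z))"
proof -
  note nonvanishing = normal_W_max_nonvanishing[OF normal nonzero]
  note eq = normal_W_max_functional_equation[OF hol normal nonzero]
  show ?thesis
  proof (cases "A = 0")
    case True
    then have "\<psi> w = \<psi> 0 * exp (cnj B * w)" for w
      using eq[of w 0] nonvanishing[of 0] by (simp add: exp_minus field_simps)
    then show ?thesis
      using that[of "\<psi> 0" "cnj B"] nonvanishing by blast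
  next
    case False
    have "\<psi> (u + h) * \<psi> 0 = \<psi> h * \<psi> u" for u h
    proof -
      define w where "w = u / cnj A"
      then have w: "cnj A * w = u"
        using False by simp
      have "\<psi> u = \<psi> w * exp ((A - 1) * cnj B * w)"
        using eq[of w 0] nonvanishing[of 0] by (simp only: w) simp
      then show ?thesis
        using eq[of w h] by (simp only: w mult.assoc)
    qed
    from multiplicative_entire_imp_exp[OF hol nonvanishing this]
    obtain D where "\<And>z. \<psi> z = \<psi> 0 * exp (D * z)"
      by blast
    then show ?thesis
      using that[of "\<psi> 0" D] nonvanishing by blast
  qed
qed

subsection \<open>Affine exponential symbols\<close>

abbreviation affine_exp_comp ::
    "complex \<Rightarrow> complex \<Rightarrow> complex \<Rightarrow> complex \<Rightarrow> (complex \<Rightarrow> complex) \<Rightarrow> complex \<Rightarrow> complex" where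
  "affine_exp_comp A B C D \<equiv> weighted_comp (\<lambda>z. C * exp (D * z)) (\<lambda>z. A * z + B)"

abbreviation affine_exp_W_max :: "complex \<Rightarrow> complex \<Rightarrow> complex \<Rightarrow> complex \<Rightarrow> fock_operator" where
  "affine_exp_W_max A B C D \<equiv> W_max (\<lambda>z. C * exp (D * z)) (\<lambda>z. A * z + B)"

abbreviation adj_affine_exp_comp ::
    "complex \<Rightarrow> complex \<Rightarrow> complex \<Rightarrow> complex \<Rightarrow> (complex \<Rightarrow> complex) \<Rightarrow> complex \<Rightarrow> complex" where
  "adj_affine_exp_comp A B C D \<equiv> affine_exp_comp (cnj A) (cnj D) (cnj C) (cnj B)"

abbreviation adj_affine_exp_W_max :: "complex \<Rightarrow> complex \<Rightarrow> complex \<Rightarrow> complex \<Rightarrow> fock_operator" where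
  "adj_affine_exp_W_max A B C D \<equiv> affine_exp_W_max (cnj A) (cnj D) (cnj C) (cnj B)"

lemma affine_exp_comp_holomorphic:
  assumes "f holomorphic_on UNIV"
  shows "affine_exp_comp A B C D f holomorphic_on UNIV"
  unfolding weighted_comp_def by (intro holomorphic_intros holomorphic_on_compose_entire[OF assms])

lemma affine_exp_comp_kernel:
  "affine_exp_comp A B C D (fock_kernel w) = (\<lambda>z. C * exp (B * cnj w) * fock_kernel (cnj A * w + cnj D) z)"
  unfolding weighted_comp_def fock_kernel_def mult.assoc exp_add[symmetric]
  by (simp add: algebra_simps)

lemma kernel_in_op_dom_affine_exp_W_max: "fock_kernel w \<in> op_dom (affine_exp_W_max A B C D)"
  by (simp add: op_dom_W_max affine_exp_comp_kernel fock_space_cmult)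

lemma densely_defined_affine_exp_W_max: "densely_defined (affine_exp_W_max A B C D)"
  by (intro densely_defined_if_kernels_in_dom linear_operator_W_max kernel_in_op_dom_affine_exp_W_max)

lemma normal_affine_exp_imp_constants:
  assumes normal: "normal_operator (affine_exp_W_max A B C D)" and C: "C \<noteq> 0"
  shows "cmod B = cmod D" and "D * (1 - cnj A) = cnj B * (1 - A)"
proof -
  have exponents: "Re (B * cnj w) + (cmod (cnj A * w + cnj D))\<^sup>2 / 2 = Re (D * w) + (cmod (A * w + B))\<^sup>2 / 2" for w
  proof -
    have "cmod C * exp (Re (B * cnj w) + (cmod (cnj A * w + cnj D))\<^sup>2 / 2)
        = fock_norm (affine_exp_comp A B C D (fock_kernel w))"
      by (simp only: affine_exp_comp_kernel fock_norm_cmult fock_norm_kernel norm_mult norm_exp_eq_Re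
          exp_add mult.assoc)
    also have "\<dots> = cmod C * exp (Re (D * w) + (cmod (A * w + B))\<^sup>2 / 2)"
      by (simp only: normal_W_max_kernel_norm[OF normal] norm_mult norm_exp_eq_Re exp_add mult.assoc)
    finally show ?thesis
      using C by (simp del: times_complex.sel)
  qed
  show equal_norms: "cmod B = cmod D"
    using exponents[of 0] by (simp add: power2_eq_iff_nonneg)
  have Re_zero: "Re ((D * (1 - cnj A) - cnj B * (1 - A)) * w) = 0" for w
  proof -
    have "(cmod (A * w + B))\<^sup>2 - (cmod (cnj A * w + cnj D))\<^sup>2 = 2 * Re (A * w * cnj B) - 2 * Re (cnj A * w * D)"
      using equal_norms[unfolded cmod_def] unfolding cmod_power2 by (simp add: algebra_simps power2_eq_square)
    then show ?thesis
      using exponents[of w] by (simp add: algebra_simps)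
  qed
  have "D * (1 - cnj A) - cnj B * (1 - A) = 0"
    using Re_zero[of 1] Re_zero[of \<i>] by (simp add: complex_eq_iff)
  then show "D * (1 - cnj A) = cnj B * (1 - A)"
    by simp
qed

lemma fock_space_mult_exp_square_bound:
  assumes g: "g \<in> fock_space" and z: "0 \<le> Re z" "Re z \<le> 1"
  shows "cmod (g (m * z) * exp (of_real ((cmod m)\<^sup>2) * z\<^sup>2 / 2 + of_real \<nu> * z))
    \<le> fock_norm g * exp ((cmod m)\<^sup>2 + \<bar>\<nu>\<bar>)"
proof -
  define \<mu> where "\<mu> = (cmod m)\<^sup>2"
  have norm_mz: "(cmod (m * z))\<^sup>2 = \<mu> * ((Re z)\<^sup>2 + (Im z)\<^sup>2)"
    by (simp add: norm_mult power_mult_distrib \<mu>_def cmod_power2[of z])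
  have "(cmod (m * z))\<^sup>2 / 2 + Re (of_real \<mu> * z\<^sup>2 / 2 + of_real \<nu> * z) = \<mu> * (Re z)\<^sup>2 + \<nu> * Re z"
    unfolding norm_mz by (simp add: power2_eq_square field_simps)
  also have "\<dots> \<le> \<mu> * 1 + \<bar>\<nu>\<bar> * 1"
    using z by (intro add_mono mult_mono) (auto simp: \<mu>_def power_le_one)
  finally have exponent: "(cmod (m * z))\<^sup>2 / 2 + Re (of_real \<mu> * z\<^sup>2 / 2 + of_real \<nu> * z) \<le> \<mu> + \<bar>\<nu>\<bar>"
    by simp
  have "cmod (g (m * z) * exp (of_real \<mu> * z\<^sup>2 / 2 + of_real \<nu> * z))
      \<le> fock_norm g * exp ((cmod (m * z))\<^sup>2 / 2) * exp (Re (of_real \<mu> * z\<^sup>2 / 2 + of_real \<nu> * z))"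
    unfolding norm_mult[of "g _"] norm_exp_eq_Re by (intro mult_right_mono fock_pointwise_bound g) auto
  also have "\<dots> = fock_norm g * exp ((cmod (m * z))\<^sup>2 / 2 + Re (of_real \<mu> * z\<^sup>2 / 2 + of_real \<nu> * z))"
    by (simp only: exp_add mult.assoc)
  also have "\<dots> \<le> fock_norm g * exp (\<mu> + \<bar>\<nu>\<bar>)"
    using exponent by (intro mult_left_mono) simp_all
  finally show ?thesis
    by (simp only: \<mu>_def)
qed

text \<open>A Gaussian factor turns the functional equation into antiperiodicity.\<close>

lemma fock_space_weighted_translation_eq_neg_imp_zero:
  assumes g: "g \<in> fock_space" and \<kappa>: "\<kappa> > 0" and m: "m \<noteq> 0"
    and eq: "\<And>z. of_real \<kappa> * exp (z * cnj m) * g (z + m) = - g z"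
  shows "g z = 0"
proof -
  define \<mu> \<nu> where "\<mu> = (cmod m)\<^sup>2" and "\<nu> = ln \<kappa> - \<mu> / 2"
  define f where "f \<zeta> = g (m * \<zeta>) * exp (of_real \<mu> * \<zeta>\<^sup>2 / 2 + of_real \<nu> * \<zeta>)" for \<zeta>
  have "f (\<zeta> + 1) = - f \<zeta>" for \<zeta>
  proof -
    have "m * cnj m = of_real \<mu>"
      by (simp add: \<mu>_def complex_norm_square[symmetric])
    then have "of_real \<mu> * (\<zeta> + 1)\<^sup>2 / 2 + of_real \<nu> * (\<zeta> + 1)
        = of_real (ln \<kappa>) + m * \<zeta> * cnj m + (of_real \<mu> * \<zeta>\<^sup>2 / 2 + of_real \<nu> * \<zeta>)"
      by (simp add: \<nu>_def power2_eq_square field_simps)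
    then have exp_shift: "exp (of_real \<mu> * (\<zeta> + 1)\<^sup>2 / 2 + of_real \<nu> * (\<zeta> + 1))
        = of_real \<kappa> * exp (m * \<zeta> * cnj m) * exp (of_real \<mu> * \<zeta>\<^sup>2 / 2 + of_real \<nu> * \<zeta>)"
      using \<kappa> by (simp only: exp_add exp_of_real exp_ln)
    have "m * (\<zeta> + 1) = m * \<zeta> + m"
      by (simp add: distrib_left)
    then have "f (\<zeta> + 1) = of_real \<kappa> * exp (m * \<zeta> * cnj m) * g (m * \<zeta> + m)
        * exp (of_real \<mu> * \<zeta>\<^sup>2 / 2 + of_real \<nu> * \<zeta>)"
      unfolding f_def exp_shift by (simp only: mult_ac)
    then show ?thesis
      by (simp add: eq f_def)
  qed
  moreover have "f holomorphic_on UNIV"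
    unfolding f_def by (intro holomorphic_intros holomorphic_on_compose_entire[OF fock_space_holomorphic[OF g]]) auto
  moreover have "cmod (f \<zeta>) \<le> fock_norm g * exp (\<mu> + \<bar>\<nu>\<bar>)" if "0 \<le> Re \<zeta>" "Re \<zeta> \<le> 1" for \<zeta>
    unfolding f_def \<mu>_def by (rule fock_space_mult_exp_square_bound[OF g that])
  ultimately have "f (z / m) = 0"
    using entire_antiperiodic_bounded_imp_zero by blast
  then show ?thesis
    using m by (simp add: f_def)
qed

lemma affine_exp_comp_adjoint_comp:
  "affine_exp_comp A B C D (adj_affine_exp_comp A B C D f) z
    = of_real ((cmod C)\<^sup>2 * exp ((cmod B)\<^sup>2)) * exp (z * cnj (cnj A * B + cnj D))
      * f (of_real ((cmod A)\<^sup>2) * z + (cnj A * B + cnj D))"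
proof -
  have "D * z + cnj B * (A * z + B) = of_real ((cmod B)\<^sup>2) + z * cnj (cnj A * B + cnj D)"
    unfolding complex_norm_square by (simp add: algebra_simps)
  then have "exp (D * z) * exp (cnj B * (A * z + B)) = of_real (exp ((cmod B)\<^sup>2)) * exp (z * cnj (cnj A * B + cnj D))"
    by (simp only: exp_add[symmetric] exp_of_real[symmetric])
  moreover have "cnj A * (A * z + B) + cnj D = of_real ((cmod A)\<^sup>2) * z + (cnj A * B + cnj D)"
    unfolding complex_norm_square by (simp add: algebra_simps)
  moreover have "affine_exp_comp A B C D (adj_affine_exp_comp A B C D f) z
      = of_real ((cmod C)\<^sup>2) * (exp (D * z) * exp (cnj B * (A * z + B))) * f (cnj A * (A * z + B) + cnj D)"
    unfolding weighted_comp_def complex_norm_square by (simp only: mult_ac)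
  ultimately show ?thesis
    by (simp only: of_real_mult mult.assoc)
qed

lemma affine_exp_comp_adjoint_comp_eq_neg_imp_zero:
  assumes g: "g \<in> fock_space"
    and eq: "affine_exp_comp A B C D (adj_affine_exp_comp A B C D g) = (\<lambda>z. - g z)"
  shows "g z = 0"
proof -
  define m where "m = cnj A * B + cnj D"
  define \<kappa> where "\<kappa> = (cmod C)\<^sup>2 * exp ((cmod B)\<^sup>2)"
  have \<kappa>: "\<kappa> \<ge> 0"
    by (simp add: \<kappa>_def)
  have weighted_dilation: "of_real \<kappa> * exp (z * cnj m) * g (of_real ((cmod A)\<^sup>2) * z + m) = - g z" for z
    using fun_cong[OF eq, of z] by (simp only: affine_exp_comp_adjoint_comp \<kappa>_def m_def)
  show ?thesis
  proof (cases "(cmod A)\<^sup>2 = 1")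
    case False
    then show ?thesis
      using entire_weighted_dilation_eq_neg_imp_zero[OF fock_space_holomorphic[OF g] \<kappa> zero_le_power2 _
          weighted_dilation] by blast
  next
    case True
    then have translation: "of_real \<kappa> * exp (z * cnj m) * g (z + m) = - g z" for z
      using weighted_dilation[of z] by simp
    consider (zero) "\<kappa> = 0" | (scalar) "m = 0" | (proper) "\<kappa> > 0" "m \<noteq> 0"
      using \<kappa> by fastforce
    then show ?thesis
    proof cases
      case zero
      then show ?thesis
        using translation[of z] by simp
    next
      case scalar
      then have "of_real (\<kappa> + 1) * g z = 0"
        using translation[of z] by (simp add: distrib_right)
      then show ?thesis
        using \<kappa> by (simp del: of_real_add)
    next
      case proper
      then show ?thesis
        using fock_space_weighted_translation_eq_neg_imp_zero[OF g _ _ translation] by blast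
    qed
  qed
qed

lemma op_dom_adjoint_affine_exp_W_maxD:
  assumes "g \<in> op_dom (adjoint_op (affine_exp_W_max A B C D))"
  shows "g \<in> op_dom (adj_affine_exp_W_max A B C D)"
    and "\<And>f. f \<in> op_dom (affine_exp_W_max A B C D) \<Longrightarrow>
      fock_inner (affine_exp_comp A B C D f) g = fock_inner f (adj_affine_exp_comp A B C D g)"
proof -
  let ?W = "affine_exp_W_max A B C D"
  obtain h where h: "g \<in> fock_space" "h \<in> fock_space"
      "\<And>f. f \<in> op_dom ?W \<Longrightarrow> fock_inner (op_app ?W f) g = fock_inner f h"
    using op_dom_adjointE[OF assms] by blast
  have "h w = adj_affine_exp_comp A B C D g w" for w
  proof -
    have "h w = fock_inner h (fock_kernel w)"
      by (simp add: fock_reproducing h(2))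
    also have "\<dots> = fock_inner g (affine_exp_comp A B C D (fock_kernel w))"
      using h(3)[OF kernel_in_op_dom_affine_exp_W_max, of w] by (metis fock_inner_commute op_app_W_max)
    also have "\<dots> = adj_affine_exp_comp A B C D g w"
      unfolding affine_exp_comp_kernel fock_inner_cmult_right fock_reproducing[OF h(1)]
      by (simp add: weighted_comp_def exp_cnj)
    finally show ?thesis .
  qed
  then have h_eq: "h = adj_affine_exp_comp A B C D g"
    by (rule ext)
  show "g \<in> op_dom (adj_affine_exp_W_max A B C D)"
    using h(1,2) by (simp add: op_dom_W_max h_eq)
  show "fock_inner (affine_exp_comp A B C D f) g = fock_inner f (adj_affine_exp_comp A B C D g)"
    if "f \<in> op_dom ?W" for f
    using h(3)[OF that] by (simp add: op_app_W_max h_eq)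
qed

lemma affine_exp_W_max_graph_decomposition:
  assumes g: "g \<in> op_dom (adj_affine_exp_W_max A B C D)"
  obtains p where "p \<in> op_dom (affine_exp_W_max A B C D)"
    "adj_affine_exp_comp A B C D (\<lambda>z. - affine_exp_comp A B C D p z) = p"
    "\<And>q. q \<in> op_dom (affine_exp_W_max A B C D) \<Longrightarrow>
      fock_inner (affine_exp_comp A B C D q) (\<lambda>z. - g z - affine_exp_comp A B C D p z)
      = fock_inner q (\<lambda>z. p z - adj_affine_exp_comp A B C D g z)"
proof -
  let ?T = "affine_exp_W_max A B C D"
  let ?W = "affine_exp_comp A B C D" and ?V = "adj_affine_exp_comp A B C D"
  have g_fock: "g \<in> fock_space" "?V g \<in> fock_space" "(\<lambda>z. - g z) \<in> fock_space"
    using g by (simp_all add: op_dom_W_max fock_space_uminus)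
  obtain p where p: "p \<in> op_dom ?T"
      "\<And>q. q \<in> op_dom ?T \<Longrightarrow> fock_inner (?W q) (\<lambda>z. - g z - ?W p z) = fock_inner q (\<lambda>z. p z - ?V g z)"
    using closed_operator_graph_decomposition[OF linear_operator_W_max closed_operator_W_max g_fock(2,3),
        of "\<lambda>z. C * exp (D * z)" "\<lambda>z. A * z + B"]
    unfolding op_app_W_max by blast
  define h where "h = (\<lambda>z. - g z - ?W p z)"
  have fock: "h \<in> fock_space" "(\<lambda>z. p z - ?V g z) \<in> fock_space"
    unfolding h_def using p(1) g_fock by (auto simp: op_dom_W_max intro: fock_space_diff)
  have "h \<in> op_dom (adjoint_op ?T)"
    using p(2) by (intro op_dom_adjointI[OF densely_defined_affine_exp_W_max fock]) (simp add: op_app_W_max h_def)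
  note h = op_dom_adjoint_affine_exp_W_maxD[OF this]
  have "?V h = (\<lambda>z. p z - ?V g z)"
  proof (rule fock_inner_eq_on_dense[OF densely_defined_affine_exp_W_max])
    show "?V h \<in> fock_space"
      using h(1) by (simp add: op_dom_W_max)
    show "fock_inner q (?V h) = fock_inner q (\<lambda>z. p z - ?V g z)" if "q \<in> op_dom ?T" for q
      using h(2)[OF that] p(2)[OF that] by (simp only: h_def)
  qed (fact fock)
  moreover have "?V (\<lambda>z. - ?W p z) = (\<lambda>z. ?V g z + ?V h z)"
    by (simp add: h_def weighted_comp_def algebra_simps)
  ultimately have "?V (\<lambda>z. - ?W p z) = p"
    by simp
  with p show ?thesis
    using that by blast
qed

lemma affine_exp_comp_adjoint:
  assumes f: "f \<in> op_dom (affine_exp_W_max A B C D)"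
    and g: "g \<in> op_dom (adj_affine_exp_W_max A B C D)"
  shows "fock_inner (affine_exp_comp A B C D f) g = fock_inner f (adj_affine_exp_comp A B C D g)"
proof -
  let ?W = "affine_exp_comp A B C D" and ?V = "adj_affine_exp_comp A B C D"
  obtain p where p: "p \<in> op_dom (affine_exp_W_max A B C D)" "?V (\<lambda>z. - ?W p z) = p"
    and adj: "fock_inner (?W f) (\<lambda>z. - g z - ?W p z) = fock_inner f (\<lambda>z. p z - ?V g z)"
    by (rule affine_exp_W_max_graph_decomposition[OF g]) (use f in blast)
  have "- ?W p z = 0" for z
    using p
    by (intro affine_exp_comp_adjoint_comp_eq_neg_imp_zero[where A = A and B = B and C = C and D = D and
          g = "\<lambda>z. - ?W p z"]) (simp_all add: op_dom_W_max fock_space_uminus)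
  then have Wp: "?W p = (\<lambda>z. 0)"
    by (simp add: fun_eq_iff)
  with p(2) have "?V (\<lambda>z. 0) = p"
    by simp
  then have "p = (\<lambda>z. 0)"
    by (auto simp: weighted_comp_def)
  with adj Wp show ?thesis
    using fock_inner_cmult_right[of "?W f" "- 1" g] fock_inner_cmult_right[of f "- 1" "?V g"] by simp
qed

lemma
  shows op_dom_adjoint_affine_exp_W_max:
    "op_dom (adjoint_op (affine_exp_W_max A B C D)) = op_dom (adj_affine_exp_W_max A B C D)"
    and op_app_adjoint_affine_exp_W_max: "g \<in> op_dom (adj_affine_exp_W_max A B C D) \<Longrightarrow>
      op_app (adjoint_op (affine_exp_W_max A B C D)) g = adj_affine_exp_comp A B C D g"
proof -
  have adjoint: "g \<in> op_dom (adjoint_op (affine_exp_W_max A B C D)) \<and>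
      op_app (adjoint_op (affine_exp_W_max A B C D)) g = adj_affine_exp_comp A B C D g"
    if g: "g \<in> op_dom (adj_affine_exp_W_max A B C D)" for g
  proof -
    have "g \<in> fock_space" "adj_affine_exp_comp A B C D g \<in> fock_space"
      using g by (simp_all add: op_dom_W_max)
    note rule = op_dom_adjointI[OF densely_defined_affine_exp_W_max this]
      op_app_adjoint_eq[OF densely_defined_affine_exp_W_max this]
    show ?thesis
      by (intro conjI rule) (simp_all only: op_app_W_max affine_exp_comp_adjoint[OF _ g])
  qed
  then show "op_dom (adjoint_op (affine_exp_W_max A B C D)) = op_dom (adj_affine_exp_W_max A B C D)"
    using op_dom_adjoint_affine_exp_W_maxD(1) by blast
  show "g \<in> op_dom (adj_affine_exp_W_max A B C D) \<Longrightarrow>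
      op_app (adjoint_op (affine_exp_W_max A B C D)) g = adj_affine_exp_comp A B C D g"
    using adjoint by blast
qed

lemma norm_affine_exp_comp_gaussian:
  "(cmod (affine_exp_comp A B C D f z))\<^sup>2 * gaussian z
    = (cmod C)\<^sup>2 * exp ((cmod D)\<^sup>2) * (cmod (f (A * z + B)))\<^sup>2 * gaussian (z - cnj D)"
proof -
  have "(cmod (affine_exp_comp A B C D f z))\<^sup>2 * gaussian z
      = (cmod C)\<^sup>2 * (cmod (f (A * z + B)))\<^sup>2 * ((cmod (exp (D * z)))\<^sup>2 * gaussian z)"
    by (simp only: weighted_comp_def norm_mult power_mult_distrib mult_ac)
  then show ?thesis
    unfolding norm_exp_mult_gaussian by (simp only: mult_ac)
qed

text \<open>The rigid motion \<open>z \<mapsto> \<alpha> (z - B) + cnj D\<close> with \<open>A \<alpha> = cnj A\<close> intertwines the two symbols and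
  matches the two Gaussians.\<close>

lemma affine_exp_comp_rigid_motion:
  assumes relation: "D * (1 - cnj A) = cnj B * (1 - A)" and equal_norms: "cmod B = cmod D"
    and \<alpha>: "cmod \<alpha> = 1" "A * \<alpha> = cnj A"
  shows "(cmod (affine_exp_comp A B C D f (\<alpha> * z + (cnj D - \<alpha> * B))))\<^sup>2 * gaussian (\<alpha> * z + (cnj D - \<alpha> * B))
    = (cmod (adj_affine_exp_comp A B C D f z))\<^sup>2 * gaussian z"
proof -
  have "cnj D * (1 - A) = B * (1 - cnj A)"
    using arg_cong[OF relation, of cnj] by simp
  then have "A * (\<alpha> * z + (cnj D - \<alpha> * B)) + B = (A * \<alpha>) * z - (A * \<alpha>) * B + cnj D + B * cnj A"
    by (simp add: algebra_simps)
  then have arg: "A * (\<alpha> * z + (cnj D - \<alpha> * B)) + B = cnj A * z + cnj D"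
    by (simp add: \<alpha>(2))
  have "\<alpha> * z + (cnj D - \<alpha> * B) - cnj D = \<alpha> * (z - B)"
    by (simp add: algebra_simps)
  then have "gaussian (\<alpha> * z + (cnj D - \<alpha> * B) - cnj D) = gaussian (z - B)"
    by (simp add: norm_mult \<alpha>(1))
  then show ?thesis
    unfolding norm_affine_exp_comp_gaussian arg by (simp add: equal_norms)
qed

lemma
  assumes f: "f holomorphic_on UNIV"
    and relation: "D * (1 - cnj A) = cnj B * (1 - A)" and equal_norms: "cmod B = cmod D"
  shows affine_exp_comp_in_fock_space_iff_adjoint:
      "affine_exp_comp A B C D f \<in> fock_space \<longleftrightarrow> adj_affine_exp_comp A B C D f \<in> fock_space"
    and fock_norm_affine_exp_comp_eq_adjoint:
      "fock_norm (affine_exp_comp A B C D f) = fock_norm (adj_affine_exp_comp A B C D f)"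
proof -
  obtain \<alpha> where \<alpha>: "cmod \<alpha> = 1" "A * \<alpha> = cnj A"
  proof
    show "cmod (if A = 0 then 1 else cnj A / A) = 1" "A * (if A = 0 then 1 else cnj A / A) = cnj A"
      by (simp_all add: norm_divide)
  qed
  have hol: "affine_exp_comp A B C D f holomorphic_on UNIV" for A B C D
    by (rule affine_exp_comp_holomorphic[OF f])
  note [measurable] = holomorphic_borel_measurable[OF hol]
  define F where "F z = (cmod (affine_exp_comp A B C D f z))\<^sup>2 * gaussian z" for z
  have F: "F \<in> borel_measurable borel"
    unfolding F_def by measurable
  have F_shift: "F (\<alpha> * z + (cnj D - \<alpha> * B)) = (cmod (adj_affine_exp_comp A B C D f z))\<^sup>2 * gaussian z" for z
    unfolding F_def by (rule affine_exp_comp_rigid_motion[OF relation equal_norms \<alpha>])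
  note rotation = orthogonal_transformation_mult_left[OF \<alpha>(1)]
  show "affine_exp_comp A B C D f \<in> fock_space \<longleftrightarrow> adj_affine_exp_comp A B C D f \<in> fock_space"
    using integrable_lborel_rigid_motion[OF rotation F, of "cnj D - \<alpha> * B"] hol
    unfolding F_shift by (simp add: fock_space_def F_def[abs_def])
  have "(fock_norm (affine_exp_comp A B C D f))\<^sup>2 = (fock_norm (adj_affine_exp_comp A B C D f))\<^sup>2"
    using integral_lborel_rigid_motion[OF rotation F, of "cnj D - \<alpha> * B"]
    unfolding F_shift by (simp add: fock_norm_power2 F_def)
  then show "fock_norm (affine_exp_comp A B C D f) = fock_norm (adj_affine_exp_comp A B C D f)"
    by (simp add: power2_eq_iff_nonneg)
qed

lemma normal_affine_exp_W_max:
  assumes relation: "D * (1 - cnj A) = cnj B * (1 - A)" and equal_norms: "cmod B = cmod D"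
  shows "normal_operator (affine_exp_W_max A B C D)"
proof -
  have dom: "op_dom (affine_exp_W_max A B C D) = op_dom (adj_affine_exp_W_max A B C D)"
    using affine_exp_comp_in_fock_space_iff_adjoint[OF fock_space_holomorphic relation equal_norms]
    by (auto simp: op_dom_W_max)
  have "fock_norm (op_app (affine_exp_W_max A B C D) f)
      = fock_norm (op_app (adjoint_op (affine_exp_W_max A B C D)) f)"
    if "f \<in> op_dom (affine_exp_W_max A B C D)" for f
  proof -
    have "f holomorphic_on UNIV"
      using that by (auto simp: op_dom_W_max fock_space_holomorphic)
    then show ?thesis
      using op_app_adjoint_affine_exp_W_max that[unfolded dom]
        fock_norm_affine_exp_comp_eq_adjoint[OF _ relation equal_norms] by (simp only: op_app_W_max)
  qed
  then show ?thesis
    using dom closed_operator_W_max densely_defined_affine_exp_W_max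
    by (simp add: normal_operator_def op_dom_adjoint_affine_exp_W_max)
qed

lemma normal_W_max_iff:
  assumes "\<phi> holomorphic_on UNIV" "\<psi> holomorphic_on UNIV" "\<exists>z. \<psi> z \<noteq> 0"
  shows "normal_operator (W_max \<psi> \<phi>) \<longleftrightarrow>
    (\<exists>A B C D. (\<forall>z. \<phi> z = A * z + B) \<and> (\<forall>z. \<psi> z = C * exp (D * z)) \<and>
       D * (1 - cnj A) = cnj B * (1 - A) \<and> cmod B = cmod D)"
proof
  assume normal: "normal_operator (W_max \<psi> \<phi>)"
  obtain A B where \<phi>: "\<phi> = (\<lambda>z. A * z + B)"
    using normal_W_max_affine[OF assms(1) normal assms(3)] .
  obtain C D where "C \<noteq> 0" and \<psi>: "\<psi> = (\<lambda>z. C * exp (D * z))"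
    using normal_W_max_exp[OF assms(2) normal[unfolded \<phi>] assms(3)] .
  then show "\<exists>A B C D. (\<forall>z. \<phi> z = A * z + B) \<and> (\<forall>z. \<psi> z = C * exp (D * z)) \<and>
      D * (1 - cnj A) = cnj B * (1 - A) \<and> cmod B = cmod D"
    using normal_affine_exp_imp_constants[OF normal[unfolded \<phi> \<psi>]] \<phi> \<psi> by blast
next
  assume "\<exists>A B C D. (\<forall>z. \<phi> z = A * z + B) \<and> (\<forall>z. \<psi> z = C * exp (D * z)) \<and>
      D * (1 - cnj A) = cnj B * (1 - A) \<and> cmod B = cmod D"
  then obtain A B C D where "\<phi> = (\<lambda>z. A * z + B)" "\<psi> = (\<lambda>z. C * exp (D * z))"
      "D * (1 - cnj A) = cnj B * (1 - A)" "cmod B = cmod D"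
    by (auto simp: fun_eq_iff)
  then show "normal_operator (W_max \<psi> \<phi>)"
    using normal_affine_exp_W_max by simp
qed

lemma normality_constants_iff:
  "D * (1 - cnj A) = cnj B * (1 - A) \<and> cmod B = cmod D \<longleftrightarrow>
    A \<noteq> 1 \<and> D = cnj B * (1 - A) * inverse (1 - cnj A) \<or> A = 1 \<and> cmod B = cmod D"
proof (cases "A = 1")
  case False
  then have nonzero: "1 - A \<noteq> 0" "1 - cnj A \<noteq> 0"
    by (auto simp: complex_eq_iff)
  have "D * (1 - cnj A) = cnj B * (1 - A) \<longleftrightarrow> D = cnj B * (1 - A) * inverse (1 - cnj A)"
    using nonzero by (auto simp: field_simps)
  moreover have "cmod B = cmod D" if "D * (1 - cnj A) = cnj B * (1 - A)"
  proof -
    have "cmod (1 - cnj A) = cmod (1 - A)"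
      using complex_mod_cnj[of "1 - A"] by simp
    moreover have "cmod D * cmod (1 - cnj A) = cmod B * cmod (1 - A)"
      using arg_cong[OF that, of cmod] by (simp add: norm_mult)
    ultimately show ?thesis
      using nonzero by simp
  qed
  ultimately show ?thesis
    using False by blast
qed simp

theorem theorem6p3:
  fixes \<phi> \<psi> :: "complex \<Rightarrow> complex"
  assumes "\<phi> holomorphic_on UNIV" and "\<psi> holomorphic_on UNIV"
    and "\<exists>z. \<psi> z \<noteq> 0"
  shows "normal_operator (W_max \<psi> \<phi>) \<longleftrightarrow>
    (\<exists>A B C D :: complex.
       ((\<forall>z. \<phi> z = A * z + B) \<and> A \<noteq> 1 \<and> (\<forall>z. \<psi> z = C * exp (D * z)) \<and>
          D = cnj B * (1 - A) * inverse (1 - cnj A))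
     \<or> ((\<forall>z. \<phi> z = z + B) \<and> (\<forall>z. \<psi> z = C * exp (D * z)) \<and> cmod B = cmod D))"
proof -
  have translation: "(\<forall>z. \<phi> z = z + B) \<longleftrightarrow> (\<forall>z. \<phi> z = 1 * z + B)" for B
    by simp
  show ?thesis
    unfolding normal_W_max_iff[OF assms] normality_constants_iff translation by blast
qed

end
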